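(* Let $k$ be an infinite field, $R=k[x_1,\ldots,x_m]$, $I\subset R$ a homogeneous ideal, $A=R/I$ and $d=\dim A$. Let $\{\mathcal V_n\}_{n\ge0}$ be the projective varieties in $\mathbb P_k^{md-1}$ associated with $A$ as defined in the context. Let $n\ge0$ be any given integer, and let $Q$ be an ideal generated by $d$ linear forms of $A$ which is parameterized by $\alpha\in\mathbb P_k^{md-1}$. Then (i) $\mathcal V_n\supseteq\mathcal V_{n+1}$; (ii) $Q$ is a minimal reduction of $A$ with $r_Q(A)=n$ if and only if $\alpha\in\mathcal V_n\setminus\mathcal V_{n+1}$.
   Context: $A=R/I$ is a standard graded $k$-algebra (so $I$ is proper). A reduction of $A$ is an ideal $Q$ generated by linear forms (elements of $A_1$) such that $Q_n=A_n$ for all large $n$. The reduction number $r_Q(A)$ of $A$ with respect to $Q$ is the least $n\ge0$ with $Q_{n+1}=A_{n+1}$. A reduction is minimal if it contains no other reduction (equivalently, it is a reduction generated by $d$ linear forms). An ideal $Q$ generated by $d$ linear forms of $A$ is parameterized by $\alpha=(\alpha_{ij})$ ($1\le i\le d$, $1\le j\le m$, $\alpha_{ij}\in k$) if $Q=(y_1,\ldots,y_d,I)/I$ with $y_i=\sum_{j=1}^m\alpha_{ij}x_j$; a nonzero $\alpha$ is viewed as a point of $\mathbb P_k^{md-1}$. Let $u=\{u_{ij}\mid 1\le i\le d,\ 1\le j\le m\}$ be indeterminates and $z_i=\sum_{j=1}^m u_{ij}x_j$. Fix generators $I=(f_1,\ldots,f_v)$ with $f_j$ a form of degree $d_j$.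 For $n\ge0$, $M_n(u)$ is the matrix with entries in $k[u]$ of the coefficients of the elements $z_ig$ ($g$ a monomial of $R$ of degree $n-1$) and $f_jh$ ($h$ a monomial of $R$ of degree $n-d_j$), written as linear combinations of the monomials of degree $n$ in $x_1,\ldots,x_m$. With $N=\binom{n+m-1}{m-1}$, $J_n$ is the ideal of $k[u]$ generated by the $N\times N$ minors of $M_n(u)$ ($J_n=0$ if one of the sizes of $M_n(u)$ is less than $N$; in particular $J_0=0$). $\mathcal V_n\subseteq\mathbb P_k^{md-1}$ is the zero locus of $J_n$, i.e. the set of points with coordinates in $k$ at which all elements of $J_n$ vanish. *)

theory Defs
  imports
    "HOL-Library.Poly_Mapping"
    "HOL-Library.Extended_Nat"
    "HOL-Algebra.QuotRing"
    "Jordan_Normal_Form.Determinant"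
    "Jordan_Normal_Form.DL_Submatrix"
begin

text \<open>A polynomial is a finitely supported map from exponent vectors to coefficients.\<close>

type_synonym ('v, 'c) mpol = "('v \<Rightarrow>\<^sub>0 nat) \<Rightarrow>\<^sub>0 'c"

definition mdeg :: "('v \<Rightarrow>\<^sub>0 nat) \<Rightarrow> nat" where
  "mdeg e = (\<Sum>v\<in>Poly_Mapping.keys e. Poly_Mapping.lookup e v)"

definition monomials :: "'v set \<Rightarrow> nat \<Rightarrow> ('v \<Rightarrow>\<^sub>0 nat) set" where
  "monomials V n = {e. Poly_Mapping.keys e \<subseteq> V \<and> mdeg e = n}"

definition mon :: "('v \<Rightarrow>\<^sub>0 nat) \<Rightarrow> ('v, 'c::comm_ring_1) mpol" where
  "mon e = Poly_Mapping.single e 1"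

definition Var :: "'v \<Rightarrow> ('v, 'c::comm_ring_1) mpol" where
  "Var v = mon (Poly_Mapping.single v 1)"

definition Const :: "'c \<Rightarrow> ('v, 'c::comm_ring_1) mpol" where
  "Const c = Poly_Mapping.single 0 c"

definition eval :: "('v \<Rightarrow> 'c) \<Rightarrow> ('v, 'c::comm_ring_1) mpol \<Rightarrow> 'c" where
  "eval a p = (\<Sum>e\<in>Poly_Mapping.keys p.
     Poly_Mapping.lookup p e * (\<Prod>v\<in>Poly_Mapping.keys e. a v ^ Poly_Mapping.lookup e v))"

definition mpoly_ring :: "'v set \<Rightarrow> ('v, 'c::comm_ring_1) mpol ring" where
  "mpoly_ring V =
     \<lparr>carrier = {p. \<forall>e\<in>Poly_Mapping.keys p. Poly_Mapping.keys e \<subseteq> V},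
      monoid.mult = (*), one = 1, zero = 0, add = (+)\<rparr>"

text \<open>The zero polynomial is a form of every degree.\<close>

definition form :: "'v set \<Rightarrow> nat \<Rightarrow> ('v, 'c::comm_ring_1) mpol \<Rightarrow> bool" where
  "form V n p \<longleftrightarrow> Poly_Mapping.keys p \<subseteq> monomials V n"

definition homogeneous_ideal :: "'v set \<Rightarrow> ('v, 'c::comm_ring_1) mpol set \<Rightarrow> bool" where
  "homogeneous_ideal V I \<longleftrightarrow> ideal I (mpoly_ring V) \<and>
     (\<exists>S. (\<forall>f\<in>S. \<exists>n. form V n f) \<and> I = Idl\<^bsub>mpoly_ring V\<^esub> S)"

abbreviation xring :: "nat \<Rightarrow> (nat, 'k::field) mpol ring" where
  "xring m \<equiv> mpoly_ring {1..m}"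

definition krull_dim :: "('a, 'b) ring_scheme \<Rightarrow> enat" where
  "krull_dim A = Sup {enat n | n. \<exists>P. (\<forall>i\<le>n. primeideal (P i) A) \<and> (\<forall>i<n. P i \<subset> P (Suc i))}"

text \<open>In the following, \<open>G n\<close> is the homogeneous component of degree \<open>n\<close> of the graded ring \<open>A\<close>.\<close>

definition reduction :: "('a, 'b) ring_scheme \<Rightarrow> (nat \<Rightarrow> 'a set) \<Rightarrow> 'a set \<Rightarrow> bool" where
  "reduction A G Q \<longleftrightarrow> (\<exists>S \<subseteq> G 1. Q = Idl\<^bsub>A\<^esub> S) \<and> (\<exists>n0. \<forall>n\<ge>n0. Q \<inter> G n = G n)"

definition minimal_reduction :: "('a, 'b) ring_scheme \<Rightarrow> (nat \<Rightarrow> 'a set) \<Rightarrow> 'a set \<Rightarrow> bool" where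
  "minimal_reduction A G Q \<longleftrightarrow>
     reduction A G Q \<and> (\<forall>Q'. reduction A G Q' \<and> Q' \<subseteq> Q \<longrightarrow> Q' = Q)"

definition reduction_number :: "(nat \<Rightarrow> 'a set) \<Rightarrow> 'a set \<Rightarrow> nat" where
  "reduction_number G Q = (LEAST n. Q \<inter> G (n + 1) = G (n + 1))"

abbreviation quot_alg :: "nat \<Rightarrow> (nat, 'k::field) mpol set \<Rightarrow> (nat, 'k) mpol set ring" where
  "quot_alg m I \<equiv> xring m Quot I"

definition quot_comp :: "nat \<Rightarrow> (nat, 'k::field) mpol set \<Rightarrow> nat \<Rightarrow> (nat, 'k) mpol set set" where
  "quot_comp m I n = {I +>\<^bsub>xring m\<^esub> p | p. form {1..m} n p}"

definition lin_form :: "nat \<Rightarrow> (nat \<times> nat \<Rightarrow> 'k::field) \<Rightarrow> nat \<Rightarrow> (nat, 'k) mpol" where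
  "lin_form m a i = (\<Sum>j\<in>{1..m}. Const (a (i, j)) * Var j)"

text \<open>\<open>(y\<^sub>1, \<dots>, y\<^sub>d, I)/I\<close> as an ideal of \<open>R/I\<close>.\<close>

definition param_ideal ::
  "nat \<Rightarrow> (nat, 'k::field) mpol set \<Rightarrow> nat \<Rightarrow> (nat \<times> nat \<Rightarrow> 'k) \<Rightarrow> (nat, 'k) mpol set set" where
  "param_ideal m I d a =
     (\<lambda>p. I +>\<^bsub>xring m\<^esub> p) ` (Idl\<^bsub>xring m\<^esub> (lin_form m a ` {1..d} \<union> I))"

text \<open>Homogeneous coordinates indexed by \<open>V\<close> are represented by nonzero functions that vanish
  outside \<open>V\<close>; a point is the set of all its coordinate vectors.\<close>

definition hom_coords :: "'v set \<Rightarrow> ('v \<Rightarrow> 'k::field) set" where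
  "hom_coords V = {a. (\<forall>v. v \<notin> V \<longrightarrow> a v = 0) \<and> (\<exists>v\<in>V. a v \<noteq> 0)}"

definition proj_point :: "('v \<Rightarrow> 'k::field) \<Rightarrow> ('v \<Rightarrow> 'k) set" where
  "proj_point a = {\<lambda>v. c * a v | c. c \<noteq> 0}"

definition proj_space :: "'v set \<Rightarrow> ('v \<Rightarrow> 'k::field) set set" where
  "proj_space V = proj_point ` hom_coords V"

definition proj_zeros :: "'v set \<Rightarrow> ('v, 'k::field) mpol set \<Rightarrow> ('v \<Rightarrow> 'k) set set" where
  "proj_zeros V J = {P \<in> proj_space V. \<forall>a\<in>P. \<forall>p\<in>J. eval a p = 0}"

text \<open>The indeterminate \<open>u\<^sub>i\<^sub>j\<close> is \<open>Var (i, j)\<close>.\<close>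

definition uvars :: "nat \<Rightarrow> nat \<Rightarrow> (nat \<times> nat) set" where
  "uvars d m = {1..d} \<times> {1..m}"

text \<open>\<open>z\<^sub>i\<close> and the forms \<open>f\<^sub>j\<close> are regarded as polynomials in \<open>x\<close> with coefficients in \<open>k[u]\<close>.\<close>

definition zform :: "nat \<Rightarrow> nat \<Rightarrow> (nat, (nat \<times> nat, 'k::field) mpol) mpol" where
  "zform m i = (\<Sum>j\<in>{1..m}. Const (Var (i, j)) * Var j)"

definition lift_coeffs :: "(nat, 'k::field) mpol \<Rightarrow> (nat, (nat \<times> nat, 'k) mpol) mpol" where
  "lift_coeffs p = Poly_Mapping.map Const p"

definition mon_list :: "nat \<Rightarrow> nat \<Rightarrow> (nat \<Rightarrow>\<^sub>0 nat) list" where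
  "mon_list m n = sorted_list_of_set (monomials {1..m} n)"

text \<open>Monomials of degree \<open>n - e\<close>; there are none if \<open>n < e\<close>, where natural subtraction truncates.\<close>

definition comon_list :: "nat \<Rightarrow> nat \<Rightarrow> nat \<Rightarrow> (nat \<Rightarrow>\<^sub>0 nat) list" where
  "comon_list m n e = (if e \<le> n then mon_list m (n - e) else [])"

definition row_polys ::
  "nat \<Rightarrow> nat \<Rightarrow> nat \<Rightarrow> (nat \<Rightarrow> (nat, 'k::field) mpol) \<Rightarrow> (nat \<Rightarrow> nat) \<Rightarrow> nat
    \<Rightarrow> (nat, (nat \<times> nat, 'k) mpol) mpol list" where
  "row_polys m d v f dg n =
     [zform m i * mon g. i \<leftarrow> [1..<Suc d], g \<leftarrow> comon_list m n 1] @
     [lift_coeffs (f j) * mon h. j \<leftarrow> [1..<Suc v], h \<leftarrow> comon_list m n (dg j)]"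

definition Mmat ::
  "nat \<Rightarrow> nat \<Rightarrow> nat \<Rightarrow> (nat \<Rightarrow> (nat, 'k::field) mpol) \<Rightarrow> (nat \<Rightarrow> nat) \<Rightarrow> nat
    \<Rightarrow> (nat \<times> nat, 'k) mpol mat" where
  "Mmat m d v f dg n =
     mat (length (row_polys m d v f dg n)) (length (mon_list m n))
       (\<lambda>(r, c). Poly_Mapping.lookup (row_polys m d v f dg n ! r) (mon_list m n ! c))"

definition minors :: "nat \<Rightarrow> 'a::comm_ring_1 mat \<Rightarrow> 'a set" where
  "minors r M = {det (submatrix M S T) | S T.
     S \<subseteq> {..<dim_row M} \<and> T \<subseteq> {..<dim_col M} \<and> card S = r \<and> card T = r}"

text \<open>\<open>minors r M\<close> is empty, hence generates the zero ideal, if a dimension of \<open>M\<close> is less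
  than \<open>r\<close>.\<close>

definition Jideal ::
  "nat \<Rightarrow> nat \<Rightarrow> nat \<Rightarrow> (nat \<Rightarrow> (nat, 'k::field) mpol) \<Rightarrow> (nat \<Rightarrow> nat) \<Rightarrow> nat
    \<Rightarrow> (nat \<times> nat, 'k) mpol set" where
  "Jideal m d v f dg n =
     Idl\<^bsub>mpoly_ring (uvars d m)\<^esub> (minors ((n + m - 1) choose (m - 1)) (Mmat m d v f dg n))"

definition Vvar ::
  "nat \<Rightarrow> nat \<Rightarrow> nat \<Rightarrow> (nat \<Rightarrow> (nat, 'k::field) mpol) \<Rightarrow> (nat \<Rightarrow> nat) \<Rightarrow> nat
    \<Rightarrow> (nat \<times> nat \<Rightarrow> 'k) set set" where
  "Vvar m d v f dg n = proj_zeros (uvars d m) (Jideal m d v f dg n)"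

end

theory Submission
  imports Defs
begin

text \<open>
  The \<open>N \<times> N\<close> minors of \<open>M\<^sub>n(\<alpha>)\<close> all vanish if and only if its rows do not span
  the forms of degree \<open>n\<close>, that is, if and only if some form of degree \<open>n\<close> is not in
  \<open>(y\<^sub>1, \<dots>, y\<^sub>d, I)\<close>. Hence \<open>\<alpha>\<close> lies in \<open>V\<^sub>n\<close> but not in \<open>V\<^sub>n\<^sub>+\<^sub>1\<close> if and
  only if \<open>n + 1\<close> is the least degree from which on \<open>Q\<close> and \<open>A\<close> agree. It remains to see that such
  a \<open>Q\<close> is minimal: a strictly smaller reduction would be generated by fewer than \<open>d\<close> linear
  forms \<open>l\<^sub>1, \<dots>, l\<^sub>r\<close>, and \<open>A\<close> would be finite over the algebra they generate. Counting
  monomials, any \<open>d\<close> elements of \<open>A\<close> then satisfy a polynomial relation over \<open>k\<close>. Applied to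
  \<open>t\<^sub>i \<in> P\<^sub>i\<^sub>+\<^sub>1 - P\<^sub>i\<close> for a chain of primes \<open>P\<^sub>0 \<subset> \<dots> \<subset> P\<^sub>d\<close>, such a relation
  leads, by cancelling powers of \<open>t\<^sub>0, t\<^sub>1, \<dots>\<close> in turn, to a nonzero constant in \<open>P\<^sub>d\<close>.
\<close>

subsection \<open>Monomials and forms\<close>

text \<open>Every ideal of \<open>R/I\<close> is the image of an ideal of \<open>R\<close>
  containing \<open>I\<close>, so \<open>Q\<close> is replaced by its preimage
  \<open>(y_1, ..., y_d, I)\<close> and all linear algebra takes place among polynomials. The
  obstacle in proving minimality is that a competing reduction may be generated by any set of linear
  forms of \<open>A\<close>, that the \<open>y_i\<close> may be dependent modulo \<open>I\<close>,
  and that the dimension is only given by chains of primes, which need not be homogeneous. The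
  elements \<open>t i\<close> are therefore arbitrary polynomials, and the count runs along the
  filtration by degree instead of the grading: up to degree N, finiteness over r linear forms
  leaves, modulo \<open>I\<close>, a space of dimension at most a constant times (N + 1)^r, while
  the monomials in d polynomials grow with exponent d > r. The relation so obtained holds modulo
  \<open>I\<close>, hence in \<open>P 0\<close>, which is all that the chain argument asks
  for.\<close>

lemma mpol_eq_sum_single:
  fixes p :: "('v, 'c::comm_ring_1) mpol"
  shows "p = (\<Sum>e\<in>Poly_Mapping.keys p. Poly_Mapping.single e (Poly_Mapping.lookup p e))"
  by (rule poly_mapping_eqI)
     (simp add: lookup_sum lookup_single when_def in_keys_iff)

lemma mpol_induct [case_names single add]:
  fixes p :: "('v, 'c::comm_ring_1) mpol"
  assumes "\<And>e c. P (Poly_Mapping.single e c)"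
    and "\<And>p q. P p \<Longrightarrow> P q \<Longrightarrow> P (p + q)"
  shows "P p"
proof -
  have "P (\<Sum>e\<in>A. Poly_Mapping.single e (Poly_Mapping.lookup p e))" if "finite A" for A
    using that
  proof (induction A)
    case empty
    have "P (Poly_Mapping.single 0 0)" by (rule assms(1))
    then show ?case by simp
  next
    case (insert e A)
    then show ?case by (simp add: assms)
  qed
  from this[of "Poly_Mapping.keys p"] show ?thesis
    using mpol_eq_sum_single[of p] by simp
qed

text \<open>Natural exponents cannot cancel, which turns the usual inclusion for sums into an
  equality.\<close>

lemma keys_add_nat:
  fixes e f :: "'v \<Rightarrow>\<^sub>0 nat"
  shows "Poly_Mapping.keys (e + f) = Poly_Mapping.keys e \<union> Poly_Mapping.keys f"
  by (auto simp: in_keys_iff lookup_add)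

lemma mdeg_zero [simp]: "mdeg 0 = 0"
  by (simp add: mdeg_def)

lemma mdeg_add: "mdeg (e + f) = mdeg e + mdeg f"
  unfolding mdeg_def by (rule setsum_keys_plus_distrib) auto

lemma mdeg_single [simp]: "mdeg (Poly_Mapping.single v n) = n"
  by (simp add: mdeg_def)

lemma mdeg_eq_0_iff: "mdeg e = 0 \<longleftrightarrow> e = 0"
proof
  assume "mdeg e = 0"
  then have "\<forall>v\<in>Poly_Mapping.keys e. Poly_Mapping.lookup e v = 0"
    by (simp add: mdeg_def)
  then have "Poly_Mapping.lookup e v = 0" for v
    by (cases "v \<in> Poly_Mapping.keys e") (auto simp: in_keys_iff)
  then show "e = 0"
    by (intro poly_mapping_eqI) simp
qed simp

lemma monomials_add:
  "e \<in> monomials V n \<Longrightarrow> f \<in> monomials V k \<Longrightarrow> e + f \<in> monomials V (n + k)"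
  by (auto simp: monomials_def mdeg_add keys_add_nat)

lemma monomials_Suc:
  assumes "e \<in> monomials V (Suc n)"
  obtains v f where "v \<in> V" "f \<in> monomials V n" "e = Poly_Mapping.single v 1 + f"
proof -
  from assms have "e \<noteq> 0" by (auto simp: monomials_def)
  then obtain v where v: "v \<in> Poly_Mapping.keys e"
    by (metis in_keys_iff poly_mapping_eqI lookup_zero)
  define f where "f = e - Poly_Mapping.single v 1"
  have ef: "e = Poly_Mapping.single v 1 + f"
    using v by (intro poly_mapping_eqI)
      (auto simp: f_def lookup_add lookup_minus lookup_single when_def in_keys_iff)
  moreover have "f \<in> monomials V n"
    using assms unfolding ef by (auto simp: monomials_def mdeg_add keys_add_nat)
  moreover have "v \<in> V" using v assms by (auto simp: monomials_def)
  ultimately show ?thesis using that by blast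
qed

lemma mon_mult: "mon e * mon f = mon (e + f)"
  by (simp add: mon_def mult_single)

lemma mon_zero [simp]: "mon 0 = 1"
  by (simp add: mon_def)

lemma Const_mult_single: "Const c * Poly_Mapping.single e b = Poly_Mapping.single e (c * b)"
  by (simp add: Const_def mult_single)

lemma Const_mult_mon: "Const c * mon e = Poly_Mapping.single e c"
  by (simp add: mon_def Const_mult_single)

lemma Const_add: "Const (a + b) = Const a + Const b"
  by (simp add: Const_def single_add)

lemma Const_mult: "Const (a * b) = Const a * Const b"
  by (simp add: Const_def mult_single)

lemma Const_0 [simp]: "Const 0 = 0" by (simp add: Const_def)
lemma Const_1 [simp]: "Const 1 = 1" by (simp add: Const_def)
lemma Const_uminus: "Const (- a) = - Const a" by (simp add: Const_def single_uminus)

lemma lookup_Const_mult: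
  "Poly_Mapping.lookup (Const c * p) e = c * Poly_Mapping.lookup p e"
  by (induction p rule: mpol_induct)
     (simp_all add: Const_mult_single lookup_single when_def distrib_left lookup_add)

text \<open>The existential says that the monomial \<open>g\<close> divides \<open>e\<close>;
  without it the truncated \<open>e - g\<close> would produce spurious coefficients.\<close>

lemma lookup_mult_mon:
  "Poly_Mapping.lookup (p * mon g) e
    = (if \<exists>f. e = f + g then Poly_Mapping.lookup p (e - g) else 0)"
proof (induction p rule: mpol_induct)
  case (single f c)
  show ?case
    by (cases "e = f + g") (auto simp: mon_def mult_single lookup_single when_def)
next
  case (add p q)
  then show ?case by (simp add: distrib_right lookup_add)
qed

subsection \<open>Polynomials as a vector space\<close>

text \<open>Scalars act through constant polynomials, so that spans, independence and dimension
  bounds become available for polynomials.\<close>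

interpretation mp: vector_space "\<lambda>c p :: ('v, 'k::field) mpol. Const c * p"
  by unfold_locales (simp_all add: algebra_simps Const_add Const_mult)

definition hcomp :: "nat \<Rightarrow> ('v, 'c::comm_ring_1) mpol \<Rightarrow> ('v, 'c) mpol" where
  "hcomp n p = (\<Sum>e\<in>{e\<in>Poly_Mapping.keys p. mdeg e = n}.
     Poly_Mapping.single e (Poly_Mapping.lookup p e))"

lemma lookup_hcomp:
  "Poly_Mapping.lookup (hcomp n p) e = (if mdeg e = n then Poly_Mapping.lookup p e else 0)"
  by (auto simp: hcomp_def lookup_sum lookup_single when_def in_keys_iff sum.delta
      cong: if_cong)

lemma hcomp_add: "hcomp n (p + q) = hcomp n p + hcomp n q"
  by (rule poly_mapping_eqI) (simp add: lookup_hcomp lookup_add)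

lemma hcomp_0 [simp]: "hcomp n 0 = 0"
  by (rule poly_mapping_eqI) (simp add: lookup_hcomp)

lemma hcomp_sum: "hcomp n (sum f A) = (\<Sum>x\<in>A. hcomp n (f x))"
  by (induction A rule: infinite_finite_induct) (simp_all add: hcomp_add)

lemma hcomp_single:
  "hcomp n (Poly_Mapping.single e c) = (if mdeg e = n then Poly_Mapping.single e c else 0)"
  by (rule poly_mapping_eqI) (auto simp: lookup_hcomp lookup_single when_def)

lemma hcomp_single_mult:
  "hcomp n (Poly_Mapping.single e c * p)
    = (if mdeg e \<le> n then Poly_Mapping.single e c * hcomp (n - mdeg e) p else 0)"
proof (induction p rule: mpol_induct)
  case (single f b)
  then show ?case by (auto simp: mult_single hcomp_single mdeg_add)
next
  case (add p q)
  then show ?case by (auto simp: distrib_left hcomp_add)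
qed

lemma form_hcomp:
  assumes "form V d p"
  shows "hcomp n p = (if n = d then p else 0)"
  using assms
  by (intro poly_mapping_eqI)
     (auto simp: lookup_hcomp form_def monomials_def subset_iff in_keys_iff)

lemma form_0 [simp]: "form V n 0"
  by (simp add: form_def)

lemma form_add: "form V n p \<Longrightarrow> form V n q \<Longrightarrow> form V n (p + q)"
  unfolding form_def using keys_add[of p q] by blast

lemma form_mult: "form V n p \<Longrightarrow> form V k q \<Longrightarrow> form V (n + k) (p * q)"
  unfolding form_def using keys_mult[of p q] monomials_add by blast

lemma form_single: "e \<in> monomials V n \<Longrightarrow> form V n (Poly_Mapping.single e c)"
  by (simp add: form_def)

lemma form_mon: "e \<in> monomials V n \<Longrightarrow> form V n (mon e)"
  by (simp add: mon_def form_single)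

lemma form_Const: "form V 0 (Const c)"
  by (auto simp: Const_def form_def monomials_def)

lemma form_Const_mult: "form V n p \<Longrightarrow> form V n (Const c * p)"
  using form_mult[OF form_Const[of V c]] by fastforce

lemma form_sum: "(\<And>x. x \<in> A \<Longrightarrow> form V n (f x)) \<Longrightarrow> form V n (sum f A)"
  by (induction A rule: infinite_finite_induct) (simp_all add: form_add)

lemma form_lin_form: "form {1..m} 1 (lin_form m a i)"
  unfolding lin_form_def Var_def
  by (intro form_sum form_Const_mult form_mon) (simp add: monomials_def)

lemma subspace_form: "mp.subspace {p. form V n p}"
  by (auto simp: mp.subspace_def intro: form_add form_Const_mult)

lemma form_in_span_mon:
  assumes "form V n p"
  shows "p \<in> mp.span (mon ` monomials V n)"
proof -
  have "(\<Sum>e\<in>Poly_Mapping.keys p. Const (Poly_Mapping.lookup p e) * mon e)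
      \<in> mp.span (mon ` monomials V n)"
    using assms by (intro mp.span_sum mp.span_scale mp.span_base) (auto simp: form_def)
  then show ?thesis
    using mpol_eq_sum_single[of p] by (simp add: Const_mult_mon)
qed

lemma forms_eq_span: "{p. form V n p} = mp.span (mon ` monomials V n)"
proof
  show "mp.span (mon ` monomials V n) \<subseteq> {p. form V n p}"
    by (rule mp.span_minimal[OF _ subspace_form]) (auto intro: form_mon)
qed (auto intro: form_in_span_mon)

subsection \<open>Ideals of polynomial rings\<close>

lemma mpoly_ring_simps [simp]:
  "monoid.mult (mpoly_ring V) = (*)" "one (mpoly_ring V) = 1"
  "zero (mpoly_ring V) = 0" "add (mpoly_ring V) = (+)"
  by (simp_all add: mpoly_ring_def)

lemma carrier_mpoly_ring:
  "p \<in> carrier (mpoly_ring V) \<longleftrightarrow> (\<forall>e\<in>Poly_Mapping.keys p. Poly_Mapping.keys e \<subseteq> V)"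
  by (simp add: mpoly_ring_def)

lemma carrier_add:
  "p \<in> carrier (mpoly_ring V) \<Longrightarrow> q \<in> carrier (mpoly_ring V) \<Longrightarrow> p + q \<in> carrier (mpoly_ring V)"
  using keys_add[of p q] by (auto simp: carrier_mpoly_ring)

lemma carrier_mult:
  "p \<in> carrier (mpoly_ring V) \<Longrightarrow> q \<in> carrier (mpoly_ring V) \<Longrightarrow> p * q \<in> carrier (mpoly_ring V)"
  using keys_mult[of p q] by (fastforce simp: carrier_mpoly_ring keys_add_nat)

lemma carrier_single:
  "Poly_Mapping.keys e \<subseteq> V \<Longrightarrow> Poly_Mapping.single e c \<in> carrier (mpoly_ring V)"
  by (simp add: carrier_mpoly_ring)

lemma carrier_Const [simp]: "Const c \<in> carrier (mpoly_ring V)"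
  by (simp add: Const_def carrier_single)

lemma carrier_0 [simp]: "0 \<in> carrier (mpoly_ring V)"
  and carrier_1 [simp]: "1 \<in> carrier (mpoly_ring V)"
  by (simp_all add: carrier_mpoly_ring)

lemma carrier_uminus: "p \<in> carrier (mpoly_ring V) \<Longrightarrow> - p \<in> carrier (mpoly_ring V)"
  using carrier_mult[OF carrier_Const[of "-1"], of p] by (simp add: Const_uminus)

lemma carrier_form: "form V n p \<Longrightarrow> p \<in> carrier (mpoly_ring V)"
  by (auto simp: form_def carrier_mpoly_ring monomials_def)

lemma carrier_sum:
  "(\<And>x. x \<in> A \<Longrightarrow> f x \<in> carrier (mpoly_ring V)) \<Longrightarrow> sum f A \<in> carrier (mpoly_ring V)"
  by (induction A rule: infinite_finite_induct) (simp_all add: carrier_add)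

lemma carrier_prod:
  "(\<And>x. x \<in> A \<Longrightarrow> f x \<in> carrier (mpoly_ring V)) \<Longrightarrow> prod f A \<in> carrier (mpoly_ring V)"
  by (induction A rule: infinite_finite_induct) (simp_all add: carrier_mult)

lemma cring_mpoly_ring: "cring (mpoly_ring V)"
proof (rule cringI)
  show "abelian_group (mpoly_ring V)"
    by (rule abelian_groupI)
       (auto simp: carrier_add add.assoc add.commute intro: carrier_uminus
         intro!: bexI[of _ "- _"])
  show "comm_monoid (mpoly_ring V)"
    by (rule comm_monoidI) (auto simp: carrier_mult ac_simps)
qed (simp add: algebra_simps)

lemma ring_mpoly_ring: "ring (mpoly_ring V)"
  using cring_mpoly_ring by (rule cring.axioms)

lemma a_inv_mpoly_ring:
  assumes "p \<in> carrier (mpoly_ring V)"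
  shows "a_inv (mpoly_ring V) p = - p"
proof -
  interpret cring "mpoly_ring V" by (rule cring_mpoly_ring)
  show ?thesis
    using minus_equality[of "- p" p] assms carrier_uminus[OF assms] by simp
qed

text \<open>Closure under negatives comes for free, as \<open>- p\<close> is the multiple of
  \<open>p\<close> by the constant -1.\<close>

lemma ideal_mpoly_ring_iff:
  fixes J :: "('v, 'c::comm_ring_1) mpol set"
  shows "ideal J (mpoly_ring V) \<longleftrightarrow> J \<subseteq> carrier (mpoly_ring V) \<and> 0 \<in> J \<and>
     (\<forall>p\<in>J. \<forall>q\<in>J. p + q \<in> J) \<and> (\<forall>p\<in>J. \<forall>q\<in>carrier (mpoly_ring V). q * p \<in> J)"
    (is "?L \<longleftrightarrow> ?R")
proof
  assume ?L
  then interpret ideal J "mpoly_ring V" .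
  note S = is_additive_subgroup
  show ?R
    using additive_subgroup.a_subset[OF S] additive_subgroup.zero_closed[OF S]
      additive_subgroup.a_closed[OF S] I_l_closed
    by simp
next
  assume R: ?R
  interpret cring "mpoly_ring V" by (rule cring_mpoly_ring)
  have neg: "- p \<in> J" if "p \<in> J" for p
  proof -
    have "Const (-1) * p \<in> J" using R that carrier_Const[of "-1" V] by blast
    then show ?thesis by (simp add: Const_uminus)
  qed
  show ?L
  proof (rule idealI)
    show "subgroup J (add_monoid (mpoly_ring V))"
    proof (rule add.subgroupI)
      show "J \<subseteq> carrier (mpoly_ring V)" "J \<noteq> {}" using R by blast+
      fix a b assume ab: "a \<in> J" "b \<in> J"
      have "a \<in> carrier (mpoly_ring V)" using R ab(1) by blast
      then show "\<ominus>\<^bsub>mpoly_ring V\<^esub> a \<in> J"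
        using neg[OF ab(1)] by (simp only: a_inv_mpoly_ring)
      show "a \<oplus>\<^bsub>mpoly_ring V\<^esub> b \<in> J" using R ab by simp
    qed
  next
    fix a x :: "('v, 'c) mpol" assume "a \<in> J" "x \<in> carrier (mpoly_ring V)"
    then have "x * a \<in> J" using R by blast
    then show "x \<otimes>\<^bsub>mpoly_ring V\<^esub> a \<in> J" "a \<otimes>\<^bsub>mpoly_ring V\<^esub> x \<in> J"
      by (simp_all add: mult.commute)
  qed (rule ring_mpoly_ring)
qed

lemma
  assumes "ideal J (mpoly_ring V)"
  shows ideal_carrierD: "p \<in> J \<Longrightarrow> p \<in> carrier (mpoly_ring V)"
    and ideal_0: "0 \<in> J"
    and ideal_add: "p \<in> J \<Longrightarrow> q \<in> J \<Longrightarrow> p + q \<in> J"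
    and ideal_mult: "p \<in> J \<Longrightarrow> q \<in> carrier (mpoly_ring V) \<Longrightarrow> q * p \<in> J"
    and ideal_mult2: "p \<in> J \<Longrightarrow> q \<in> carrier (mpoly_ring V) \<Longrightarrow> p * q \<in> J"
  using assms unfolding ideal_mpoly_ring_iff by (blast, blast, blast, blast, metis mult.commute)

lemma ideal_uminus: "ideal J (mpoly_ring V) \<Longrightarrow> p \<in> J \<Longrightarrow> - p \<in> J"
  using ideal_mult[OF _ _ carrier_Const[of "-1"], of J V p] by (simp add: Const_uminus)

lemma ideal_diff: "ideal J (mpoly_ring V) \<Longrightarrow> p \<in> J \<Longrightarrow> q \<in> J \<Longrightarrow> p - q \<in> J"
  using ideal_add[of J V p "- q"] ideal_uminus[of J V q] by simp

lemma ideal_sum: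
  "ideal J (mpoly_ring V) \<Longrightarrow> (\<And>x. x \<in> A \<Longrightarrow> f x \<in> J) \<Longrightarrow> sum f A \<in> J"
  by (induction A rule: infinite_finite_induct) (auto intro: ideal_0 ideal_add)

lemma ideal_subspace:
  fixes J :: "('v, 'k::field) mpol set"
  shows "ideal J (mpoly_ring V) \<Longrightarrow> mp.subspace J"
  by (auto simp: mp.subspace_def intro: ideal_0 ideal_add ideal_mult)

lemma
  assumes "X \<subseteq> carrier (mpoly_ring V)"
  shows Idl_ideal: "ideal (Idl\<^bsub>mpoly_ring V\<^esub> X) (mpoly_ring V)"
    and Idl_incl: "X \<subseteq> Idl\<^bsub>mpoly_ring V\<^esub> X"
  using ring.genideal_ideal[OF ring_mpoly_ring assms] ring.genideal_self[OF ring_mpoly_ring assms]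
  by auto

lemma Idl_least: "ideal J (mpoly_ring V) \<Longrightarrow> X \<subseteq> J \<Longrightarrow> Idl\<^bsub>mpoly_ring V\<^esub> X \<subseteq> J"
  by (rule ring.genideal_minimal[OF ring_mpoly_ring])

text \<open>If every member of \<open>Y\<close> is a form of its recorded degree, the span is the
  degree \<open>n\<close> part of the ideal that they generate. The degree is stored with the
  generator because the zero polynomial is a form of every degree and does not determine
  one.\<close>

definition gens :: "'v set \<Rightarrow> (nat \<times> ('v, 'c::comm_ring_1) mpol) set \<Rightarrow> nat \<Rightarrow> ('v, 'c) mpol set"
  where "gens V Y n = {x * mon g | \<delta> x g. (\<delta>, x) \<in> Y \<and> \<delta> \<le> n \<and> g \<in> monomials V (n - \<delta>)}"

lemma mon_mult_span_gens:
  fixes Y :: "(nat \<times> ('v, 'k::field) mpol) set"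
  assumes "r \<in> mp.span (gens V Y k)" and e: "Poly_Mapping.keys e \<subseteq> V"
  shows "mon e * r \<in> mp.span (gens V Y (mdeg e + k))"
  using assms(1)
proof (induction rule: mp.span_induct_alt)
  case base
  then show ?case by (simp add: mp.span_zero)
next
  case (step c x y)
  from step(1) obtain \<delta> z g where z: "x = z * mon g" "(\<delta>, z) \<in> Y" "\<delta> \<le> k" "g \<in> monomials V (k - \<delta>)"
    by (auto simp: gens_def)
  have "e + g \<in> monomials V (mdeg e + k - \<delta>)"
    using monomials_add[of e V "mdeg e" g "k - \<delta>"] z e by (simp add: monomials_def)
  then have "z * mon (e + g) \<in> gens V Y (mdeg e + k)"
    using z unfolding gens_def by force
  then have "Const c * (z * mon (e + g)) + mon e * y \<in> mp.span (gens V Y (mdeg e + k))"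
    by (intro mp.span_add mp.span_scale mp.span_base step(2))
  then show ?case
    by (simp add: z(1) mon_mult[symmetric] algebra_simps)
qed

text \<open>The polynomials all of whose homogeneous components lie in these spans form an ideal,
  and it contains each generator, whose only possible nonzero component is itself. So no explicit
  representation of the elements of the ideal is required.\<close>

lemma hcomp_Idl_forms:
  fixes Y :: "(nat \<times> ('v, 'k::field) mpol) set"
  assumes Y: "\<And>\<delta> x. (\<delta>, x) \<in> Y \<Longrightarrow> form V \<delta> x"
    and p: "p \<in> Idl\<^bsub>mpoly_ring V\<^esub> (snd ` Y)"
  shows "hcomp n p \<in> mp.span (gens V Y n)"
proof -
  define J where "J = {p \<in> carrier (mpoly_ring V). \<forall>n. hcomp n p \<in> mp.span (gens V Y n)}"
  have mult: "hcomp n (q * p) \<in> mp.span (gens V Y n)"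
    if p: "p \<in> J" and q: "q \<in> carrier (mpoly_ring V)" for p q n
  proof -
    have "q * p = (\<Sum>e\<in>Poly_Mapping.keys q. Poly_Mapping.single e (Poly_Mapping.lookup q e) * p)"
      by (subst mpol_eq_sum_single[of q]) (simp add: sum_distrib_right)
    moreover have "hcomp n (Poly_Mapping.single e (Poly_Mapping.lookup q e) * p)
        \<in> mp.span (gens V Y n)" if "e \<in> Poly_Mapping.keys q" for e
    proof (cases "mdeg e \<le> n")
      case True
      have "mon e * hcomp (n - mdeg e) p \<in> mp.span (gens V Y (mdeg e + (n - mdeg e)))"
        using p q that by (intro mon_mult_span_gens) (auto simp: J_def carrier_mpoly_ring)
      then have "Const (Poly_Mapping.lookup q e) * (mon e * hcomp (n - mdeg e) p)
          \<in> mp.span (gens V Y n)"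
        using True by (intro mp.span_scale) simp
      then show ?thesis
        using True by (simp add: hcomp_single_mult Const_mult_mon mult.assoc[symmetric])
    qed (simp add: hcomp_single_mult mp.span_zero)
    ultimately show ?thesis
      by (simp add: hcomp_sum mp.span_sum)
  qed
  have "ideal J (mpoly_ring V)"
    unfolding ideal_mpoly_ring_iff
  proof (intro conjI ballI)
    fix p q :: "('v, 'k) mpol"
    assume "p \<in> J" "q \<in> carrier (mpoly_ring V)"
    with mult[OF this] show "q * p \<in> J" by (simp add: J_def carrier_mult)
  qed (auto simp: J_def carrier_add hcomp_add mp.span_add mp.span_zero)
  moreover have "snd ` Y \<subseteq> J"
  proof
    fix x :: "('v, 'k) mpol"
    assume "x \<in> snd ` Y"
    then obtain \<delta> where dx: "(\<delta>, x) \<in> Y" by auto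
    have "(0 :: 'v \<Rightarrow>\<^sub>0 nat) \<in> monomials V (\<delta> - \<delta>)" by (simp add: monomials_def)
    with dx have "x * mon 0 \<in> gens V Y \<delta>"
      unfolding gens_def by blast
    then have "hcomp n x \<in> mp.span (gens V Y n)" for n
      using form_hcomp[OF Y[OF dx], of n] by (cases "n = \<delta>") (simp_all add: mp.span_zero mp.span_base)
    then show "x \<in> J"
      using carrier_form[OF Y[OF dx]] by (simp add: J_def)
  qed
  ultimately have "Idl\<^bsub>mpoly_ring V\<^esub> (snd ` Y) \<subseteq> J"
    by (rule Idl_least)
  with p show ?thesis by (auto simp: J_def)
qed

text \<open>Turns a question on ideals into linear algebra within a single degree, which is what the
  matrix \<open>M_n\<close> can detect.\<close>

lemma forms_subset_Idl_iff:
  fixes Y :: "(nat \<times> ('v, 'k::field) mpol) set"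
  assumes Y: "\<And>\<delta> x. (\<delta>, x) \<in> Y \<Longrightarrow> form V \<delta> x"
  shows "{p. form V n p} \<subseteq> Idl\<^bsub>mpoly_ring V\<^esub> (snd ` Y) \<longleftrightarrow>
    {p. form V n p} \<subseteq> mp.span (gens V Y n)"
proof
  assume L: "{p. form V n p} \<subseteq> Idl\<^bsub>mpoly_ring V\<^esub> (snd ` Y)"
  show "{p. form V n p} \<subseteq> mp.span (gens V Y n)"
  proof clarify
    fix p :: "('v, 'k) mpol" assume p: "form V n p"
    with L have "p \<in> Idl\<^bsub>mpoly_ring V\<^esub> (snd ` Y)" by blast
    with Y have "hcomp n p \<in> mp.span (gens V Y n)" by (rule hcomp_Idl_forms)
    then show "p \<in> mp.span (gens V Y n)" using form_hcomp[OF p, of n] by simp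
  qed
next
  assume R: "{p. form V n p} \<subseteq> mp.span (gens V Y n)"
  have c: "snd ` Y \<subseteq> carrier (mpoly_ring V)"
    by (auto intro: carrier_form[OF Y])
  have "gens V Y n \<subseteq> Idl\<^bsub>mpoly_ring V\<^esub> (snd ` Y)"
  proof
    fix y assume "y \<in> gens V Y n"
    then obtain \<delta> x g where y: "y = x * mon g" "(\<delta>, x) \<in> Y" "g \<in> monomials V (n - \<delta>)"
      unfolding gens_def by blast
    from y(2) have "x \<in> snd ` Y" by (rule rev_image_eqI) simp
    then have "x \<in> Idl\<^bsub>mpoly_ring V\<^esub> (snd ` Y)"
      using Idl_incl[OF c] by blast
    then show "y \<in> Idl\<^bsub>mpoly_ring V\<^esub> (snd ` Y)"
      unfolding y(1) by (rule ideal_mult2[OF Idl_ideal[OF c]]) (rule carrier_form[OF form_mon[OF y(3)]])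
  qed
  then have "mp.span (gens V Y n) \<subseteq> Idl\<^bsub>mpoly_ring V\<^esub> (snd ` Y)"
    by (rule mp.span_minimal) (rule ideal_subspace[OF Idl_ideal[OF c]])
  with R show "{p. form V n p} \<subseteq> Idl\<^bsub>mpoly_ring V\<^esub> (snd ` Y)" by blast
qed

subsection \<open>The number of monomials\<close>

lemma mdeg_superset:
  "finite A \<Longrightarrow> Poly_Mapping.keys e \<subseteq> A \<Longrightarrow> mdeg e = (\<Sum>v\<in>A. Poly_Mapping.lookup e v)"
  unfolding mdeg_def by (rule sum.mono_neutral_left) (auto simp: in_keys_iff)

text \<open>Exponent vectors become lists with a given sum, which stars and bars counts. Variables
  are numbered from 1 and list positions from 0, whence the shift by one in the inverse.\<close>

lemma bij_betw_monomials:
  "bij_betw (\<lambda>e. map (Poly_Mapping.lookup e) [1..<Suc m]) (monomials {1..m} n)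
     {l. length l = m \<and> sum_list l = n}"
proof (rule bij_betwI')
  fix e f :: "nat \<Rightarrow>\<^sub>0 nat" assume ef: "e \<in> monomials {1..m} n" "f \<in> monomials {1..m} n"
  show "map (Poly_Mapping.lookup e) [1..<Suc m] = map (Poly_Mapping.lookup f) [1..<Suc m] \<longleftrightarrow> e = f"
  proof
    assume L: "map (Poly_Mapping.lookup e) [1..<Suc m] = map (Poly_Mapping.lookup f) [1..<Suc m]"
    show "e = f"
    proof (rule poly_mapping_eqI)
      fix v
      show "Poly_Mapping.lookup e v = Poly_Mapping.lookup f v"
      proof (cases "v \<in> {1..m}")
        case True
        then show ?thesis using L by (auto simp: map_eq_conv simp del: upt_Suc)
      next
        case False
        then have "v \<notin> Poly_Mapping.keys e" "v \<notin> Poly_Mapping.keys f"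
          using ef by (auto simp: monomials_def)
        then show ?thesis by (simp add: in_keys_iff)
      qed
    qed
  qed simp
next
  fix e :: "nat \<Rightarrow>\<^sub>0 nat" assume e: "e \<in> monomials {1..m} n"
  have "sum_list (map (Poly_Mapping.lookup e) [1..<Suc m]) = (\<Sum>v\<in>{1..m}. Poly_Mapping.lookup e v)"
    by (simp add: interv_sum_list_conv_sum_set_nat atLeastLessThanSuc_atLeastAtMost del: upt_Suc)
  also have "\<dots> = n"
    using e mdeg_superset[of "{1..m}" e] by (simp add: monomials_def)
  finally show "map (Poly_Mapping.lookup e) [1..<Suc m] \<in> {l. length l = m \<and> sum_list l = n}"
    by (simp del: upt_Suc)
next
  fix l :: "nat list" assume l: "l \<in> {l. length l = m \<and> sum_list l = n}"
  define e where "e = (\<Sum>v\<in>{1..m}. Poly_Mapping.single v (l ! (v - 1)))"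
  have lk: "Poly_Mapping.lookup e v = (if v \<in> {1..m} then l ! (v - 1) else 0)" for v
    unfolding e_def lookup_sum lookup_single when_def by simp
  have le: "map (Poly_Mapping.lookup e) [1..<Suc m] = l"
    using l by (intro nth_equalityI) (simp_all add: lk del: upt_Suc)
  have keys: "Poly_Mapping.keys e \<subseteq> {1..m}"
    by (auto simp: in_keys_iff lk split: if_splits)
  then have "mdeg e = (\<Sum>v\<in>{1..m}. Poly_Mapping.lookup e v)"
    by (intro mdeg_superset) auto
  also have "\<dots> = sum_list (map (Poly_Mapping.lookup e) [1..<Suc m])"
    by (simp add: interv_sum_list_conv_sum_set_nat atLeastLessThanSuc_atLeastAtMost del: upt_Suc)
  finally have "mdeg e = n" using l unfolding le by simp
  with keys show "\<exists>e\<in>monomials {1..m} n. l = map (Poly_Mapping.lookup e) [1..<Suc m]"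
    using le[symmetric] by (intro bexI[of _ e]) (simp_all add: monomials_def del: upt_Suc)
qed

lemma finite_monomials: "finite (monomials {1..m::nat} n)"
proof -
  have "{l :: nat list. length l = m \<and> sum_list l = n} \<subseteq> {l. set l \<subseteq> {..n} \<and> length l = m}"
    by (auto dest: member_le_sum_list)
  then have "finite {l :: nat list. length l = m \<and> sum_list l = n}"
    using finite_lists_length_eq[of "{..n}" m] finite_subset by blast
  then show ?thesis using bij_betw_finite[OF bij_betw_monomials] by blast
qed

text \<open>For \<open>m = 0\<close> truncated subtraction would give the value 1 in every degree,
  although there are no monomials of positive degree.\<close>

lemma card_monomials:
  assumes "m \<ge> 1"
  shows "card (monomials {1..m::nat} n) = (n + m - 1) choose (m - 1)"
proof -
  have "card (monomials {1..m::nat} n) = (n + m - 1) choose n"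
    using bij_betw_same_card[OF bij_betw_monomials] card_length_sum_list[of m n] by simp
  also have "\<dots> = (n + m - 1) choose (m - 1)"
    using assms binomial_symmetric[of n "n + m - 1"] by simp
  finally show ?thesis .
qed

lemma set_mon_list [simp]: "set (mon_list m n) = monomials {1..m} n"
  and distinct_mon_list [simp]: "distinct (mon_list m n)"
  and length_mon_list: "m \<ge> 1 \<Longrightarrow> length (mon_list m n) = (n + m - 1) choose (m - 1)"
  using card_monomials[of m n] finite_monomials[of m n]
  by (simp_all add: mon_list_def)

subsection \<open>Evaluation\<close>

definition mval :: "('v \<Rightarrow> 'c::comm_ring_1) \<Rightarrow> ('v \<Rightarrow>\<^sub>0 nat) \<Rightarrow> 'c" where
  "mval a e = (\<Prod>v\<in>Poly_Mapping.keys e. a v ^ Poly_Mapping.lookup e v)"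

lemma mval_add: "mval a (e + f) = mval a e * mval a f"
proof -
  have sup: "mval a g = (\<Prod>v\<in>Poly_Mapping.keys e \<union> Poly_Mapping.keys f. a v ^ Poly_Mapping.lookup g v)"
    if "Poly_Mapping.keys g \<subseteq> Poly_Mapping.keys e \<union> Poly_Mapping.keys f" for g
    unfolding mval_def using that by (intro prod.mono_neutral_left) (auto simp: in_keys_iff)
  show ?thesis
    by (simp add: sup keys_add_nat lookup_add power_add prod.distrib)
qed

lemma eval_mval:
  "eval a p = (\<Sum>e\<in>Poly_Mapping.keys p. Poly_Mapping.lookup p e * mval a e)"
  by (simp add: eval_def mval_def)

lemma eval_single: "eval a (Poly_Mapping.single e c) = c * mval a e"
  by (simp add: eval_mval)

lemma eval_add: "eval a (p + q) = eval a p + eval a q"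
  unfolding eval_mval by (rule setsum_keys_plus_distrib) (simp_all add: distrib_right)

lemma eval_mult: "eval a (p * q) = eval a p * eval a q"
proof (induction p rule: mpol_induct)
  case (single e c)
  show ?case
  proof (induction q rule: mpol_induct)
    case (single f b)
    then show ?case by (simp add: mult_single eval_single mval_add ac_simps)
  next
    case (add p q)
    then show ?case by (simp add: distrib_left eval_add)
  qed
next
  case (add p q)
  then show ?case by (simp add: distrib_right eval_add)
qed

lemma eval_0 [simp]: "eval a 0 = 0"
  by (simp add: eval_mval)

lemma eval_Const [simp]: "eval a (Const c) = c"
  by (simp add: Const_def eval_single mval_def)

lemma eval_1 [simp]: "eval a 1 = 1"
  using eval_Const[of a 1] by simp

lemma eval_Var [simp]: "eval a (Var v) = a v"
  by (simp add: Var_def mon_def eval_single mval_def)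

lemma comm_ring_hom_eval: "comm_ring_hom (eval a)"
  by unfold_locales (simp_all add: eval_add eval_mult)

lemma eval_sum: "eval a (sum f A) = (\<Sum>x\<in>A. eval a (f x))"
  by (induction A rule: infinite_finite_induct) (simp_all add: eval_add)

lemma eval_zero_on_Idl_iff:
  assumes "X \<subseteq> carrier (mpoly_ring V)"
  shows "(\<forall>p\<in>Idl\<^bsub>mpoly_ring V\<^esub> X. eval a p = 0) \<longleftrightarrow> (\<forall>p\<in>X. eval a p = 0)"
proof
  assume R: "\<forall>p\<in>X. eval a p = 0"
  have "ideal {p \<in> carrier (mpoly_ring V). eval a p = 0} (mpoly_ring V)"
    by (auto simp: ideal_mpoly_ring_iff carrier_add carrier_mult eval_add eval_mult)
  then have "Idl\<^bsub>mpoly_ring V\<^esub> X \<subseteq> {p \<in> carrier (mpoly_ring V). eval a p = 0}"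
    using R assms by (intro Idl_least) auto
  then show "\<forall>p\<in>Idl\<^bsub>mpoly_ring V\<^esub> X. eval a p = 0" by blast
qed (use Idl_incl[OF assms] in auto)

subsection \<open>Maximal minors\<close>

text \<open>A linear relation among the rows is a kernel vector of the transposed matrix. The forms
  are a family, not a set, so that a repeated row counts as a relation.\<close>

lemma det_forms_eq_0_iff:
  fixes r :: "nat \<Rightarrow> ('v, 'k::field) mpol"
  assumes r: "\<And>i. i < N \<Longrightarrow> form V n (r i)"
    and es: "set es = monomials V n" "length es = N"
  shows "det (mat N N (\<lambda>(i, j). Poly_Mapping.lookup (r i) (es ! j))) = 0 \<longleftrightarrow>
    (\<exists>c. (\<exists>i<N. c i \<noteq> 0) \<and> (\<Sum>i<N. Const (c i) * r i) = 0)" (is "det ?B = 0 \<longleftrightarrow> _")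
proof -
  have B: "?B \<in> carrier_mat N N" by simp
  have sum0: "(\<Sum>i<N. Const (c i) * r i) = 0 \<longleftrightarrow>
      (\<forall>j<N. (\<Sum>i<N. c i * Poly_Mapping.lookup (r i) (es ! j)) = 0)" for c
  proof
    assume R: "\<forall>j<N. (\<Sum>i<N. c i * Poly_Mapping.lookup (r i) (es ! j)) = 0"
    show "(\<Sum>i<N. Const (c i) * r i) = 0"
    proof (rule poly_mapping_eqI)
      fix e
      have "Poly_Mapping.lookup (\<Sum>i<N. Const (c i) * r i) e = 0"
      proof (cases "e \<in> monomials V n")
        case True
        then obtain j where "j < N" "e = es ! j" using es by (metis in_set_conv_nth)
        then show ?thesis using R by (simp add: lookup_sum lookup_Const_mult)
      next
        case False
        have "form V n (\<Sum>i<N. Const (c i) * r i)"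
          using r by (intro form_sum form_Const_mult) auto
        then show ?thesis using False by (auto simp: form_def in_keys_iff)
      qed
      then show "Poly_Mapping.lookup (\<Sum>i<N. Const (c i) * r i) e = Poly_Mapping.lookup 0 e"
        by simp
    qed
  next
    assume "(\<Sum>i<N. Const (c i) * r i) = 0"
    then have "Poly_Mapping.lookup (\<Sum>i<N. Const (c i) * r i) e = 0" for e by simp
    then show "\<forall>j<N. (\<Sum>i<N. c i * Poly_Mapping.lookup (r i) (es ! j)) = 0"
      by (simp add: lookup_sum lookup_Const_mult)
  qed
  have vec0: "transpose_mat ?B *\<^sub>v v = 0\<^sub>v N \<longleftrightarrow> (\<Sum>i<N. Const (v $ i) * r i) = 0"
    if "v \<in> carrier_vec N" for v
  proof -
    have "(transpose_mat ?B *\<^sub>v v) $ j = (\<Sum>i<N. v $ i * Poly_Mapping.lookup (r i) (es ! j))"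
      if "j < N" for j
      using that \<open>v \<in> carrier_vec N\<close>
      by (auto simp: scalar_prod_def lessThan_atLeast0 mult.commute intro!: sum.cong)
    then show ?thesis
      unfolding sum0 using that by (auto simp: vec_eq_iff)
  qed
  have "det ?B = 0 \<longleftrightarrow> det (transpose_mat ?B) = 0"
    by (simp add: det_transpose[OF B])
  also have "\<dots> \<longleftrightarrow> (\<exists>v. v \<in> carrier_vec N \<and> v \<noteq> 0\<^sub>v N \<and> transpose_mat ?B *\<^sub>v v = 0\<^sub>v N)"
    by (rule det_0_iff_vec_prod_zero_field) simp
  also have "\<dots> \<longleftrightarrow> (\<exists>c. (\<exists>i<N. c i \<noteq> 0) \<and> (\<Sum>i<N. Const (c i) * r i) = 0)"
  proof
    assume "\<exists>v. v \<in> carrier_vec N \<and> v \<noteq> 0\<^sub>v N \<and> transpose_mat ?B *\<^sub>v v = 0\<^sub>v N"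
    then obtain v where v: "v \<in> carrier_vec N" "v \<noteq> 0\<^sub>v N" "transpose_mat ?B *\<^sub>v v = 0\<^sub>v N"
      by blast
    then have "\<exists>i<N. v $ i \<noteq> 0" by (auto simp: vec_eq_iff)
    then show "\<exists>c. (\<exists>i<N. c i \<noteq> 0) \<and> (\<Sum>i<N. Const (c i) * r i) = 0"
      using v vec0 by blast
  next
    assume "\<exists>c. (\<exists>i<N. c i \<noteq> 0) \<and> (\<Sum>i<N. Const (c i) * r i) = 0"
    then obtain c i where c: "i < N" "c i \<noteq> 0" "(\<Sum>i<N. Const (c i) * r i) = 0" by blast
    have "vec N c \<in> carrier_vec N" by simp
    moreover have "vec N c \<noteq> 0\<^sub>v N" using c by (auto simp: vec_eq_iff)
    moreover have "transpose_mat ?B *\<^sub>v vec N c = 0\<^sub>v N"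
      using c(3) by (subst vec0) simp_all
    ultimately show "\<exists>v. v \<in> carrier_vec N \<and> v \<noteq> 0\<^sub>v N \<and> transpose_mat ?B *\<^sub>v v = 0\<^sub>v N"
      by blast
  qed
  finally show ?thesis .
qed

text \<open>Passes from families, as they occur in determinants, to sets, as they occur in dimension
  bounds. Injectivity enters because two equal members satisfy a relation with coefficients 1 and
  -1.\<close>

lemma (in vector_space) no_relation_iff:
  "\<not> (\<exists>c. (\<exists>i<N. c i \<noteq> 0) \<and> (\<Sum>i<N. scale (c i) (r i)) = 0) \<longleftrightarrow>
    inj_on r {..<N::nat} \<and> independent (r ` {..<N})"
proof
  assume L: "\<not> (\<exists>c. (\<exists>i<N. c i \<noteq> 0) \<and> (\<Sum>i<N. scale (c i) (r i)) = 0)"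
  have inj: "inj_on r {..<N}"
  proof (rule inj_onI, rule ccontr)
    fix i j assume ij: "i \<in> {..<N}" "j \<in> {..<N}" "r i = r j" "i \<noteq> j"
    define c :: "nat \<Rightarrow> 'a" where "c k = (if k = i then 1 else if k = j then - 1 else 0)" for k
    have "(\<Sum>k<N. scale (c k) (r k)) = (\<Sum>k\<in>{i, j}. scale (c k) (r k))"
      using ij by (intro sum.mono_neutral_right) (auto simp: c_def)
    also have "\<dots> = 0" using ij by (simp add: c_def)
    finally have "(\<Sum>k<N. scale (c k) (r k)) = 0" .
    moreover have "c i \<noteq> 0" by (simp add: c_def)
    ultimately show False using L ij by blast
  qed
  moreover have "independent (r ` {..<N})"
  proof
    assume "dependent (r ` {..<N})"
    then obtain u where u: "\<exists>v\<in>r ` {..<N}. u v \<noteq> 0" "(\<Sum>v\<in>r ` {..<N}. scale (u v) v) = 0"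
      by (auto simp: dependent_finite)
    from u(2) have "(\<Sum>i<N. scale (u (r i)) (r i)) = 0"
      by (simp add: sum.reindex[OF inj])
    with u(1) L show False by auto
  qed
  ultimately show "inj_on r {..<N} \<and> independent (r ` {..<N})" by blast
next
  assume R: "inj_on r {..<N} \<and> independent (r ` {..<N})"
  show "\<not> (\<exists>c. (\<exists>i<N. c i \<noteq> 0) \<and> (\<Sum>i<N. scale (c i) (r i)) = 0)"
  proof clarify
    fix c i assume i: "i < N" "c i \<noteq> 0" and s: "(\<Sum>i<N. scale (c i) (r i)) = 0"
    define u where "u = c \<circ> inv_into {..<N} r"
    have "u (r j) = c j" if "j < N" for j
      using R that by (simp add: u_def)
    then have "(\<Sum>v\<in>r ` {..<N}. scale (u v) v) = 0" "u (r i) \<noteq> 0"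
      using R s i by (simp_all add: sum.reindex)
    then show False
      using R independentD[of "r ` {..<N}" "r ` {..<N}" u "r i"] i by blast
  qed
qed

text \<open>An element of \<open>T\<close> outside the span of \<open>S\<close> could be added to
  \<open>S\<close>, giving more than \<open>card T\<close> independent vectors in the span of
  \<open>T\<close>.\<close>

lemma (in vector_space) independent_card_spans:
  assumes "finite T" "independent S" "S \<subseteq> span T" "card T \<le> card S"
  shows "T \<subseteq> span S"
proof (rule ccontr)
  assume "\<not> T \<subseteq> span S"
  then obtain t where t: "t \<in> T" "t \<notin> span S" by blast
  then have "independent (insert t S)" "insert t S \<subseteq> span T" "t \<notin> S"
    using assms by (auto simp: independent_insert intro: span_base)
  then have "card (insert t S) \<le> card T" "finite S"
    using independent_span_bound[OF assms(1), of "insert t S"] by auto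
  then show False using assms(4) \<open>t \<notin> S\<close> by simp
qed

lemma inj_mon: "inj (mon :: _ \<Rightarrow> ('v, 'k::field) mpol)"
proof (rule injI)
  fix e f assume "mon e = (mon f :: ('v, 'k) mpol)"
  then have "Poly_Mapping.keys (mon e :: ('v, 'k) mpol) = Poly_Mapping.keys (mon f :: ('v, 'k) mpol)"
    by simp
  then show "e = f" by (simp add: mon_def)
qed

lemma independent_mon: "mp.independent (mon ` E :: ('v, 'k::field) mpol set)"
proof
  assume "mp.dependent (mon ` E :: ('v, 'k) mpol set)"
  then obtain T u p where T: "finite T" "T \<subseteq> mon ` E" "(\<Sum>v\<in>T. Const (u v) * v) = 0"
    "p \<in> T" "u p \<noteq> (0 :: 'k)"
    unfolding mp.dependent_explicit by blast
  then obtain e where e: "p = mon e" by blast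
  have "Poly_Mapping.lookup (\<Sum>v\<in>T. Const (u v) * v) e = (\<Sum>v\<in>T. if v = p then u p else 0)"
    unfolding lookup_sum
  proof (rule sum.cong)
    fix v assume "v \<in> T"
    then obtain f where "v = mon f" using T by blast
    then show "Poly_Mapping.lookup (Const (u v) * v) e = (if v = p then u p else 0)"
      using e injD[OF inj_mon, of f e]
      by (cases "f = e") (auto simp: lookup_Const_mult mon_def lookup_single)
  qed simp
  also have "\<dots> = u p" using T by simp
  finally show False using T by simp
qed

text \<open>The forms have the monomials as a basis of \<open>N\<close> elements. A nonzero minor
  exhibits \<open>N\<close> independent rows, which must then span; conversely a basis chosen among
  the rows has \<open>N\<close> members and gives a nonzero minor.\<close>

lemma forms_subset_span_iff_minors:
  fixes L :: "(nat, 'k::field) mpol list"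
  assumes L: "\<And>p. p \<in> set L \<Longrightarrow> form {1..m} n p"
    and M: "M = mat (length L) N (\<lambda>(r, c). Poly_Mapping.lookup (L ! r) (mon_list m n ! c))"
    and N: "N = length (mon_list m n)"
  shows "{p. form {1..m} n p} \<subseteq> mp.span (set L) \<longleftrightarrow> (\<exists>d\<in>minors N M. d \<noteq> 0)"
proof -
  let ?E = "mon ` monomials {1..m} n :: (nat, 'k) mpol set"
  have cE: "card ?E = N"
    unfolding N using distinct_card[OF distinct_mon_list, of m n]
    by (simp add: card_image inj_on_subset[OF inj_mon])
  have dims: "dim_row M = length L" "dim_col M = N" by (simp_all add: M)
  have fE: "finite ?E" using finite_monomials by (rule finite_imageI)
  have LE: "set L \<subseteq> mp.span ?E" using L form_in_span_mon by blast
  \<comment> \<open>All \<open>N\<close> columns are taken, so only the choice of rows matters;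
    \<open>pick S\<close> lists the elements of \<open>S\<close> in increasing order.\<close>
  have sub: "det (submatrix M S {..<N}) \<noteq> 0 \<longleftrightarrow>
      inj_on (\<lambda>i. L ! pick S i) {..<N} \<and> mp.independent ((\<lambda>i. L ! pick S i) ` {..<N})"
    if S: "S \<subseteq> {..<length L}" "card S = N" for S
  proof -
    have pS: "pick S i < length L" if "i < N" for i
      using pick_in_set_le[of i S] S that by auto
    have pT: "pick {..<N} j = j" if "j < N" for j
      using pick_reduce_set[of j N UNIV] that by (simp add: pick_UNIV lessThan_def)
    have "{i. i < length L \<and> i \<in> S} = S" using S by auto
    then have "submatrix M S {..<N}
        = mat N N (\<lambda>(i, j). Poly_Mapping.lookup (L ! pick S i) (mon_list m n ! j))"
      unfolding submatrix_def M using S pS pT by (intro eq_matI) simp_all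
    moreover have "form {1..m} n (L ! pick S i)" if "i < N" for i
      using L pS[OF that] by simp
    ultimately show ?thesis
      unfolding mp.no_relation_iff[symmetric] using N
      by (subst det_forms_eq_0_iff[symmetric, OF _ set_mon_list]) simp_all
  qed
  show ?thesis
  proof
    assume "\<exists>d\<in>minors N M. d \<noteq> 0"
    then obtain S T where ST: "S \<subseteq> {..<length L}" "T \<subseteq> {..<N}" "card S = N" "card T = N"
      "det (submatrix M S T) \<noteq> 0"
      unfolding minors_def dims by blast
    then have "T = {..<N}" by (intro card_subset_eq) auto
    with ST sub have ind: "inj_on (\<lambda>i. L ! pick S i) {..<N}"
      "mp.independent ((\<lambda>i. L ! pick S i) ` {..<N})" by auto
    have "(\<lambda>i. L ! pick S i) ` {..<N} \<subseteq> set L"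
      using pick_in_set_le[of _ S] ST by force
    moreover from this have "?E \<subseteq> mp.span ((\<lambda>i. L ! pick S i) ` {..<N})"
      using LE ind cE by (intro mp.independent_card_spans[OF fE]) (auto simp: card_image)
    ultimately have "?E \<subseteq> mp.span (set L)"
      using mp.span_mono by blast
    then show "{p. form {1..m} n p} \<subseteq> mp.span (set L)"
      unfolding forms_eq_span by (rule mp.span_minimal) (rule mp.subspace_span)
  next
    assume A: "{p. form {1..m} n p} \<subseteq> mp.span (set L)"
    obtain B where B: "B \<subseteq> set L" "mp.independent B" "set L \<subseteq> mp.span B"
      by (rule mp.maximal_independent_subset)
    have EB: "?E \<subseteq> mp.span B"
      using A mp.span_minimal[OF B(3) mp.subspace_span] by (auto intro: form_mon)
    have "finite B" using finite_subset[OF B(1)] by simp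
    then have "N \<le> card B"
      using mp.independent_span_bound[OF _ independent_mon EB] cE by simp
    moreover have "card B \<le> N"
      using mp.independent_span_bound[OF fE B(2)] B(1) LE cE by auto
    ultimately have cB: "card B = N" by simp
    \<comment> \<open>A polynomial may occur at several positions of \<open>L\<close>;
      \<open>g\<close> selects one of them, so that \<open>S\<close> has exactly one row for each
      basis element.\<close>
    define g where "g b = (SOME i. i < length L \<and> L ! i = b)" for b
    define S where "S = g ` B"
    have "g b < length L \<and> L ! g b = b" if "b \<in> B" for b
      unfolding g_def using B(1) that
      by (intro someI_ex[of "\<lambda>i. i < length L \<and> L ! i = b"]) (auto simp: in_set_conv_nth subset_iff)
    then have g: "\<And>b. b \<in> B \<Longrightarrow> g b < length L" "\<And>b. b \<in> B \<Longrightarrow> L ! g b = b" by blast+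
    have injS: "inj_on g B"
      using g(2) by (rule inj_on_inverseI)
    have S: "S \<subseteq> {..<length L}" "card S = N"
      unfolding S_def using g(1) cB card_image[OF injS] by auto
    have finS: "finite S" using S(1) finite_subset by blast
    have "inj_on (pick S) {..<N}"
    proof (rule linorder_inj_onI)
      fix x y assume "x < y" "x \<in> {..<N}" "y \<in> {..<N}"
      then show "pick S x \<noteq> pick S y" using pick_mono_le[of y S x] S by auto
    qed auto
    moreover have "pick S ` {..<N} = S"
      using pick_in_set_le[of _ S] S finS calculation
      by (intro card_subset_eq) (auto simp: card_image)
    moreover have "inj_on ((!) L) S"
      unfolding S_def by (rule inj_onI) (auto simp: g(2))
    moreover have "(!) L ` S = B"
      unfolding S_def image_image using g(2) by simp
    ultimately have "inj_on (\<lambda>i. L ! pick S i) {..<N}" "(\<lambda>i. L ! pick S i) ` {..<N} = B"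
      using comp_inj_on[of "pick S" "{..<N}" "(!) L"] image_image[of "(!) L" "pick S" "{..<N}"]
      by (simp_all add: comp_def)
    with sub[OF S] B(2) have "det (submatrix M S {..<N}) \<noteq> 0" by simp
    moreover have "det (submatrix M S {..<N}) \<in> minors N M"
      unfolding minors_def dims using S by fastforce
    ultimately show "\<exists>d\<in>minors N M. d \<noteq> 0" by blast
  qed
qed

subsection \<open>The varieties\<close>

definition coeff_eval :: "('u \<Rightarrow> 'k::field) \<Rightarrow> (nat, ('u, 'k) mpol) mpol \<Rightarrow> (nat, 'k) mpol" where
  "coeff_eval a p = Poly_Mapping.map (eval a) p"

lemma lookup_coeff_eval:
  "Poly_Mapping.lookup (coeff_eval a p) e = eval a (Poly_Mapping.lookup p e)"
  by (simp add: coeff_eval_def Poly_Mapping.map.rep_eq when_def)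

lemma coeff_eval_mult_mon: "coeff_eval a (p * mon g) = coeff_eval a p * mon g"
  by (rule poly_mapping_eqI) (simp add: lookup_coeff_eval lookup_mult_mon)

lemma lookup_Var:
  fixes v :: 'v
  shows "Poly_Mapping.lookup (Var v) e = (if e = Poly_Mapping.single v 1 then 1 else 0)"
  by (auto simp: Var_def mon_def lookup_single when_def)

lemma coeff_eval_zform: "coeff_eval a (zform m i) = lin_form m a i"
  by (rule poly_mapping_eqI)
     (simp add: lookup_coeff_eval zform_def lin_form_def lookup_sum lookup_Const_mult eval_sum
       eval_mult lookup_Var[where 'v = nat] if_distrib[of "eval a"] cong: if_cong)

lemma coeff_eval_lift: "coeff_eval a (lift_coeffs p) = p"
  by (rule poly_mapping_eqI)
     (simp add: lookup_coeff_eval lift_coeffs_def Poly_Mapping.map.rep_eq when_def)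

text \<open>Generators of \<open>(y_1, ..., y_d, I)\<close> in the tagged form expected by
  \<open>gens\<close>; \<open>y_i\<close> has tag 1 even if it is zero.\<close>

definition xgens ::
  "nat \<Rightarrow> nat \<Rightarrow> nat \<Rightarrow> (nat \<Rightarrow> (nat, 'k::field) mpol) \<Rightarrow> (nat \<Rightarrow> nat) \<Rightarrow> (nat \<times> nat \<Rightarrow> 'k)
    \<Rightarrow> (nat \<times> (nat, 'k) mpol) set" where
  "xgens m d v f dg a = (\<lambda>i. (1, lin_form m a i)) ` {1..d} \<union> (\<lambda>j. (dg j, f j)) ` {1..v}"

lemma set_comon_list:
  "set (comon_list m n e) = (if e \<le> n then monomials {1..m} (n - e) else {})"
  by (simp add: comon_list_def del: One_nat_def)

lemma set_row_polys:
  "set (row_polys m d v f dg n) =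
     {zform m i * mon g | i g. i \<in> {1..d} \<and> g \<in> set (comon_list m n 1)} \<union>
     {lift_coeffs (f j) * mon h | j h. j \<in> {1..v} \<and> h \<in> set (comon_list m n (dg j))}"
  unfolding row_polys_def by (fastforce simp del: upt_Suc)

lemma gens_Un: "gens V (A \<union> B) n = gens V A n \<union> gens V B n"
  unfolding gens_def by blast

lemma gens_image:
  "gens V ((\<lambda>i. (D i, X i)) ` A) n
    = {X i * mon g | i g. i \<in> A \<and> g \<in> (if D i \<le> n then monomials V (n - D i) else {})}"
  unfolding gens_def by (auto split: if_splits)

text \<open>Specialising \<open>u\<close> to \<open>a\<close> commutes with multiplication by
  monomials in \<open>x\<close>, so the rows of the specialised matrix are exactly the products that
  span the degree \<open>n\<close> part of \<open>(y_1, ..., y_d, I)\<close>.\<close>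

lemma coeff_eval_row_polys:
  "coeff_eval a ` set (row_polys m d v f dg n) = gens {1..m} (xgens m d v f dg a) n"
proof -
  have im: "coeff_eval a ` {F i * mon g | i g. P i g} = {coeff_eval a (F i) * mon g | i g. P i g}"
    for F :: "nat \<Rightarrow> (nat, (nat \<times> nat, 'a) mpol) mpol" and P
    unfolding coeff_eval_mult_mon[symmetric] by blast
  show ?thesis
    unfolding set_row_polys image_Un im coeff_eval_zform coeff_eval_lift xgens_def gens_Un gens_image
      set_comon_list ..
qed

lemma form_xgens:
  assumes "\<forall>j\<in>{1..v}. form {1..m} (dg j) (f j)" and "(\<delta>, x) \<in> xgens m d v f dg a"
  shows "form {1..m} \<delta> x"
  using assms form_lin_form[of m a] by (auto simp: xgens_def)

section \<open>The minors as elements of \<open>k[u]\<close>\<close>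

lemma carrier_Var: "v \<in> V \<Longrightarrow> Var v \<in> carrier (mpoly_ring V)"
  by (simp add: Var_def mon_def carrier_single)

lemma lookup_row_polys_carrier:
  assumes "p \<in> set (row_polys m d v f dg n)"
  shows "Poly_Mapping.lookup p e \<in> carrier (mpoly_ring (uvars d m))"
proof -
  have Z: "Poly_Mapping.lookup (zform m i) e \<in> carrier (mpoly_ring (uvars d m))"
    if "Suc 0 \<le> i" "i \<le> d" for i e
    unfolding zform_def lookup_sum lookup_Const_mult
    using that
    by (intro carrier_sum carrier_mult carrier_Var)
       (auto simp: uvars_def Var_def mon_def lookup_single when_def)
  have "Poly_Mapping.lookup (lift_coeffs p) e \<in> carrier (mpoly_ring (uvars d m))"
    for p :: "(nat, 'a) mpol" and e
    by (simp add: lift_coeffs_def Poly_Mapping.map.rep_eq when_def)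
  then show ?thesis
    using assms unfolding set_row_polys by (auto simp: lookup_mult_mon intro: Z)
qed

lemma det_carrier:
  assumes A: "A \<in> carrier_mat N N"
    and e: "\<And>i j. i < N \<Longrightarrow> j < N \<Longrightarrow> A $$ (i, j) \<in> carrier (mpoly_ring V)"
  shows "det A \<in> carrier (mpoly_ring V)"
proof -
  have "signof p \<in> carrier (mpoly_ring V)" for p :: "nat \<Rightarrow> nat"
    using carrier_uminus[OF carrier_1] by (cases p rule: sign_cases) simp_all
  moreover have "(\<Prod>i = 0..<N. A $$ (i, p i)) \<in> carrier (mpoly_ring V)" if "p permutes {0..<N}" for p
    using permutes_in_image[OF that] by (intro carrier_prod e) auto
  ultimately show ?thesis
    unfolding det_def'[OF A] by (intro carrier_sum carrier_mult) auto
qed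

text \<open>The type of the entries has variables for all index pairs, and the facts on
  \<open>Idl\<close> apply only to generators within the carrier. The entries involve just the
  \<open>u_ij\<close> in range, and determinants stay in the subring.\<close>

lemma minors_carrier:
  "minors r (Mmat m d v f dg n) \<subseteq> carrier (mpoly_ring (uvars d m))"
proof
  fix x assume "x \<in> minors r (Mmat m d v f dg n)"
  then obtain S T where x: "x = det (submatrix (Mmat m d v f dg n) S T)"
    and S: "S \<subseteq> {..<dim_row (Mmat m d v f dg n)}" "card S = r"
    and T: "T \<subseteq> {..<dim_col (Mmat m d v f dg n)}" "card T = r"
    unfolding minors_def by blast
  have eq: "{i. i < dim_row (Mmat m d v f dg n) \<and> i \<in> S} = S"
    "{i. i < dim_col (Mmat m d v f dg n) \<and> i \<in> T} = T" using S T by auto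
  show "x \<in> carrier (mpoly_ring (uvars d m))"
    unfolding x
  proof (rule det_carrier[of _ r])
    show "submatrix (Mmat m d v f dg n) S T \<in> carrier_mat r r"
      using S T by (simp add: submatrix_def eq)
    fix i j assume ij: "i < r" "j < r"
    have "pick S i < dim_row (Mmat m d v f dg n)" "pick T j < dim_col (Mmat m d v f dg n)"
      using pick_in_set_le[of i S] pick_in_set_le[of j T] S T ij by auto
    then show "submatrix (Mmat m d v f dg n) S T $$ (i, j) \<in> carrier (mpoly_ring (uvars d m))"
      using ij S T by (simp add: submatrix_def eq) (simp add: Mmat_def lookup_row_polys_carrier[OF nth_mem])
  qed
qed

lemma map_mat_submatrix: "map_mat h (submatrix A S T) = submatrix (map_mat h A) S T"
proof (rule eq_matI)
  fix i j assume ij: "i < dim_row (submatrix (map_mat h A) S T)" "j < dim_col (submatrix (map_mat h A) S T)"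
  then have ij': "i < card {i. i < dim_row A \<and> i \<in> S}" "j < card {j. j < dim_col A \<and> j \<in> T}"
    by (simp_all add: dim_submatrix)
  have "pick S i < dim_row A" "pick T j < dim_col A"
    using pick_le[OF ij'(1)] pick_le[OF ij'(2)] by auto
  then show "map_mat h (submatrix A S T) $$ (i, j) = submatrix (map_mat h A) S T $$ (i, j)"
    using ij' by (simp add: submatrix_def)
qed (simp_all add: dim_submatrix)

lemma eval_minors:
  "eval a ` minors r A = minors r (map_mat (eval a) A)"
proof -
  interpret comm_ring_hom "eval a" by (rule comm_ring_hom_eval)
  have "eval a ` {det (submatrix A S T) | S T. P S T} = {eval a (det (submatrix A S T)) | S T. P S T}"
    for P by blast
  then show ?thesis
    unfolding minors_def hom_det[symmetric] map_mat_submatrix by simp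
qed

text \<open>Vanishing on \<open>J_n\<close> is vanishing on the minors; evaluation is a ring
  homomorphism and turns them into the maximal minors of the specialised matrix, which decide
  whether its rows span all forms.\<close>

lemma eval_Jideal_eq_0_iff:
  assumes "m \<ge> 1" and f: "\<forall>j\<in>{1..v}. form {1..m} (dg j) (f j)"
  shows "(\<forall>p\<in>Jideal m d v f dg n. eval a p = 0) \<longleftrightarrow>
    \<not> {p. form {1..m} n p} \<subseteq> Idl\<^bsub>xring m\<^esub> (snd ` xgens m d v f dg a)"
proof -
  let ?M = "Mmat m d v f dg n" and ?L = "map (coeff_eval a) (row_polys m d v f dg n)"
  define N where "N = (n + m - 1) choose (m - 1)"
  have N: "N = length (mon_list m n)" using length_mon_list[OF assms(1)] by (simp add: N_def)
  have setL: "set ?L = gens {1..m} (xgens m d v f dg a) n"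
    by (simp add: coeff_eval_row_polys)
  have M: "map_mat (eval a) ?M = mat (length ?L) N (\<lambda>(r, c). Poly_Mapping.lookup (?L ! r) (mon_list m n ! c))"
    by (rule eq_matI) (simp_all add: Mmat_def N lookup_coeff_eval)
  have L: "form {1..m} n p" if "p \<in> set ?L" for p
  proof -
    from that obtain \<delta> x g where "p = x * mon g" "(\<delta>, x) \<in> xgens m d v f dg a" "\<delta> \<le> n"
      "g \<in> monomials {1..m} (n - \<delta>)" unfolding setL gens_def by blast
    then show ?thesis using form_mult[OF form_xgens[OF f] form_mon, of \<delta> x d a g "n - \<delta>"] by simp
  qed
  have "(\<forall>p\<in>Jideal m d v f dg n. eval a p = 0) \<longleftrightarrow> (\<forall>p\<in>minors N ?M. eval a p = 0)"
    unfolding Jideal_def N_def[symmetric] by (rule eval_zero_on_Idl_iff[OF minors_carrier])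
  also have "\<dots> \<longleftrightarrow> \<not> (\<exists>x\<in>eval a ` minors N ?M. x \<noteq> 0)" by blast
  also have "\<dots> \<longleftrightarrow> \<not> {p. form {1..m} n p} \<subseteq> mp.span (set ?L)"
    unfolding eval_minors
    by (rule arg_cong[where f = Not], rule forms_subset_span_iff_minors[OF _ M N, symmetric]) (rule L)
  also have "\<dots> \<longleftrightarrow> \<not> {p. form {1..m} n p} \<subseteq> Idl\<^bsub>xring m\<^esub> (snd ` xgens m d v f dg a)"
    unfolding setL
    by (rule arg_cong[where f = Not], rule forms_subset_Idl_iff[symmetric]) (rule form_xgens[OF f])
  finally show ?thesis .
qed

section \<open>From coordinate vectors to projective points\<close>

lemma Idl_Un_Idl:
  assumes "X \<subseteq> carrier (mpoly_ring V)" "Y \<subseteq> carrier (mpoly_ring V)"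
  shows "Idl\<^bsub>mpoly_ring V\<^esub> (X \<union> Idl\<^bsub>mpoly_ring V\<^esub> Y) = Idl\<^bsub>mpoly_ring V\<^esub> (X \<union> Y)"
proof
  have XY: "X \<union> Y \<subseteq> carrier (mpoly_ring V)" using assms by blast
  have Y: "Idl\<^bsub>mpoly_ring V\<^esub> Y \<subseteq> carrier (mpoly_ring V)"
    using ideal_carrierD[OF Idl_ideal[OF assms(2)]] by blast
  show "Idl\<^bsub>mpoly_ring V\<^esub> (X \<union> Idl\<^bsub>mpoly_ring V\<^esub> Y) \<subseteq> Idl\<^bsub>mpoly_ring V\<^esub> (X \<union> Y)"
    using Idl_incl[OF XY] Idl_least[OF Idl_ideal[OF XY], of Y]
    by (intro Idl_least Idl_ideal[OF XY]) auto
  have XIY: "X \<union> Idl\<^bsub>mpoly_ring V\<^esub> Y \<subseteq> carrier (mpoly_ring V)" using assms Y by blast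
  show "Idl\<^bsub>mpoly_ring V\<^esub> (X \<union> Y) \<subseteq> Idl\<^bsub>mpoly_ring V\<^esub> (X \<union> Idl\<^bsub>mpoly_ring V\<^esub> Y)"
    using Idl_incl[OF XIY] Idl_incl[OF assms(2)] by (intro Idl_least Idl_ideal[OF XIY]) blast
qed

lemma lin_form_carrier: "lin_form m a i \<in> carrier (xring m)"
  using form_lin_form by (rule carrier_form)

lemma lin_form_scale: "lin_form m (\<lambda>v. c * a v) i = Const c * lin_form m a i"
  by (simp add: lin_form_def sum_distrib_left)

text \<open>Makes the ideal depend on the projective point alone. One inclusion holds for every
  scalar; applied to \<open>c\<close> and to its inverse it gives equality.\<close>

lemma Idl_lin_form_scale:
  assumes I: "I \<subseteq> carrier (xring m)" and "c \<noteq> 0"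
  shows "Idl\<^bsub>xring m\<^esub> (lin_form m (\<lambda>v. c * a v) ` {1..d} \<union> I) = Idl\<^bsub>xring m\<^esub> (lin_form m a ` {1..d} \<union> I)"
proof -
  have sub: "Idl\<^bsub>xring m\<^esub> (lin_form m (\<lambda>v. c * a v) ` {1..d} \<union> I) \<subseteq> Idl\<^bsub>xring m\<^esub> (lin_form m a ` {1..d} \<union> I)"
    for c a
  proof -
    have X: "lin_form m a ` {1..d} \<union> I \<subseteq> carrier (xring m)"
      by (rule Un_least[OF image_subsetI[OF lin_form_carrier] I])
    note J = Idl_ideal[OF X]
    show ?thesis
    proof (rule Idl_least[OF J], rule Un_least)
      show "I \<subseteq> Idl\<^bsub>xring m\<^esub> (lin_form m a ` {1..d} \<union> I)"
        using Idl_incl[OF X] by (rule order_trans[OF Un_upper2])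
      show "lin_form m (\<lambda>v. c * a v) ` {1..d} \<subseteq> Idl\<^bsub>xring m\<^esub> (lin_form m a ` {1..d} \<union> I)"
      proof (rule image_subsetI)
        fix i assume "i \<in> {1..d}"
        then have "lin_form m a i \<in> Idl\<^bsub>xring m\<^esub> (lin_form m a ` {1..d} \<union> I)"
          by (intro subsetD[OF Idl_incl[OF X]] UnI1 imageI)
        then show "lin_form m (\<lambda>v. c * a v) i \<in> Idl\<^bsub>xring m\<^esub> (lin_form m a ` {1..d} \<union> I)"
          by (subst lin_form_scale) (rule ideal_mult[OF J _ carrier_Const])
      qed
    qed
  qed
  have "(\<lambda>v. inverse c * (c * a v)) = a" using assms(2) by (intro ext) simp
  then show ?thesis
    using sub[of c a] sub[of "inverse c" "\<lambda>v. c * a v"] by (metis subset_antisym)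
qed

lemma proj_point_in_Vvar_iff:
  assumes f: "\<forall>j\<in>{1..v}. form {1..m} (dg j) (f j)"
    and I: "I = Idl\<^bsub>xring m\<^esub> (f ` {1..v})"
    and \<alpha>: "\<alpha> \<in> hom_coords (uvars d m)"
  shows "proj_point \<alpha> \<in> Vvar m d v f dg n \<longleftrightarrow>
    \<not> {p. form {1..m} n p} \<subseteq> Idl\<^bsub>xring m\<^esub> (lin_form m \<alpha> ` {1..d} \<union> I)"
proof -
  have m: "m \<ge> 1" using \<alpha> by (auto simp: hom_coords_def uvars_def)
  have fc: "f ` {1..v} \<subseteq> carrier (xring m)"
    by (rule image_subsetI) (rule carrier_form[OF f[rule_format]])
  have Ic: "I \<subseteq> carrier (xring m)"
    unfolding I using ideal_carrierD[OF Idl_ideal[OF fc]] by blast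
  have snd: "Idl\<^bsub>xring m\<^esub> (snd ` xgens m d v f dg a) = Idl\<^bsub>xring m\<^esub> (lin_form m a ` {1..d} \<union> I)" for a
    unfolding xgens_def I image_Un image_image snd_conv
    by (rule Idl_Un_Idl[OF image_subsetI[OF lin_form_carrier] fc, symmetric])
  have "proj_point \<alpha> \<in> Vvar m d v f dg n \<longleftrightarrow>
      (\<forall>b\<in>proj_point \<alpha>. \<forall>p\<in>Jideal m d v f dg n. eval b p = 0)"
    using \<alpha> unfolding Vvar_def proj_zeros_def proj_space_def by blast
  also have "\<dots> \<longleftrightarrow> (\<forall>c. c \<noteq> 0 \<longrightarrow> (\<forall>p\<in>Jideal m d v f dg n. eval (\<lambda>v. c * \<alpha> v) p = 0))"
    unfolding proj_point_def by blast
  also have "\<dots> \<longleftrightarrow> (\<forall>c. c \<noteq> 0 \<longrightarrow>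
      \<not> {p. form {1..m} n p} \<subseteq> Idl\<^bsub>xring m\<^esub> (lin_form m (\<lambda>v. c * \<alpha> v) ` {1..d} \<union> I))"
    unfolding eval_Jideal_eq_0_iff[OF m f] snd ..
  also have "\<dots> \<longleftrightarrow> (\<forall>c. c \<noteq> (0::'a) \<longrightarrow>
      \<not> {p. form {1..m} n p} \<subseteq> Idl\<^bsub>xring m\<^esub> (lin_form m \<alpha> ` {1..d} \<union> I))"
    by (intro all_cong1 imp_cong refl arg_cong[where f = Not] arg_cong[where f = "(\<subseteq>) _"]
        Idl_lin_form_scale[OF Ic])
  \<comment> \<open>The scalar no longer occurs in the body, and 1 shows that the quantifier is not
    vacuous.\<close>
  also have "\<dots> \<longleftrightarrow> \<not> {p. form {1..m} n p} \<subseteq> Idl\<^bsub>xring m\<^esub> (lin_form m \<alpha> ` {1..d} \<union> I)"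
    by (meson one_neq_zero)
  finally show ?thesis .
qed

text \<open>Forms are spanned by monomials, and a monomial of degree \<open>n + 1\<close> is a
  variable times one of degree \<open>n\<close>. This is the source of part (i).\<close>

lemma forms_subset_Suc:
  fixes J :: "('v, 'k::field) mpol set"
  assumes J: "ideal J (mpoly_ring V)" and n: "{p. form V n p} \<subseteq> J"
  shows "{p. form V (Suc n) p} \<subseteq> J"
  unfolding forms_eq_span
proof (rule mp.span_minimal[OF _ ideal_subspace[OF J]], rule image_subsetI)
  fix e assume "e \<in> monomials V (Suc n)"
  then obtain v f where *: "v \<in> V" "f \<in> monomials V n" "e = Poly_Mapping.single v 1 + f"
    by (rule monomials_Suc)
  have "mon e = Var v * (mon f :: ('v, 'k) mpol)" by (simp add: *(3) Var_def mon_mult)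
  moreover have "form V n (mon f :: ('v, 'k) mpol)" using *(2) by (rule form_mon)
  with n have "mon f \<in> J" by blast
  then have "Var v * mon f \<in> J" by (rule ideal_mult[OF J _ carrier_Var[OF *(1)]])
  ultimately show "mon e \<in> J" by simp
qed

declare One_nat_def [simp del]

lemma snd_forms_carrier:
  assumes "\<And>\<delta> x. (\<delta>, x) \<in> Y \<Longrightarrow> form V \<delta> x"
  shows "snd ` Y \<subseteq> carrier (mpoly_ring V)"
  by (auto intro: carrier_form[OF assms])

subsection \<open>Chains of prime ideals\<close>

text \<open>The monomial in \<open>t j, t (Suc j), ...\<close> with exponent list \<open>es\<close>.
  The start index lets the cancellation of \<open>t j\<close> pass to the tail of the list.\<close>

fun lprod :: "(nat \<Rightarrow> 'a::comm_monoid_mult) \<Rightarrow> nat \<Rightarrow> nat list \<Rightarrow> 'a" where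
  "lprod t j [] = 1"
| "lprod t j (a # es) = t j ^ a * lprod t (Suc j) es"

lemma carrier_power: "p \<in> carrier (mpoly_ring V) \<Longrightarrow> p ^ a \<in> carrier (mpoly_ring V)"
  by (induction a) (simp_all add: carrier_mult)

lemma lprod_carrier:
  "(\<And>i. j \<le> i \<Longrightarrow> i < j + length es \<Longrightarrow> t i \<in> carrier (mpoly_ring V)) \<Longrightarrow>
    lprod t j es \<in> carrier (mpoly_ring V)"
proof (induction es arbitrary: j)
  case (Cons a es)
  have "t j \<in> carrier (mpoly_ring V)" by (rule Cons.prems) simp_all
  moreover have "lprod t (Suc j) es \<in> carrier (mpoly_ring V)"
    by (rule Cons.IH) (rule Cons.prems; simp)
  ultimately show ?case by (simp add: carrier_mult carrier_power)
qed simp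

text \<open>A chain of primes lifted to the polynomial ring. Only inclusions are recorded between
  neighbours; their strictness is carried by the witnesses \<open>t i\<close>.\<close>

locale prime_chain =
  fixes V :: "'v set" and P :: "nat \<Rightarrow> ('v, 'k::field) mpol set" and d :: nat
    and t :: "nat \<Rightarrow> ('v, 'k) mpol"
  assumes ideal_P: "i \<le> d \<Longrightarrow> ideal (P i) (mpoly_ring V)"
    and prime_P: "i \<le> d \<Longrightarrow> p \<in> carrier (mpoly_ring V) \<Longrightarrow> q \<in> carrier (mpoly_ring V) \<Longrightarrow>
      p * q \<in> P i \<Longrightarrow> p \<in> P i \<or> q \<in> P i"
    and proper_P: "i \<le> d \<Longrightarrow> 1 \<notin> P i"
    and mono_P: "i < d \<Longrightarrow> P i \<subseteq> P (Suc i)"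
    and t_in: "i < d \<Longrightarrow> t i \<in> P (Suc i)"
    and t_notin: "i < d \<Longrightarrow> t i \<notin> P i"
begin

lemma t_carrier: "i < d \<Longrightarrow> t i \<in> carrier (mpoly_ring V)"
  using ideal_carrierD[OF ideal_P t_in, of i] by simp

lemma lprod_t_carrier: "j + length es \<le> d \<Longrightarrow> lprod t j es \<in> carrier (mpoly_ring V)"
  by (intro lprod_carrier t_carrier) simp

lemma power_notin: "i < d \<Longrightarrow> t i ^ a \<notin> P i"
proof (induction a)
  case (Suc a)
  then show ?case
    using prime_P[of i "t i" "t i ^ a"] t_carrier[of i] t_notin[of i] by (auto simp: carrier_power)
qed (use proper_P in simp)

text \<open>Among the terms of a putative relation, those with the least exponent of \<open>t j\<close> survive
  modulo \<open>P (Suc j)\<close> after cancelling this power of \<open>t j\<close>, which is not in the prime \<open>P j\<close>.\<close>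

lemma no_relation:
  assumes "j \<le> d" "finite E" "E \<noteq> {}" "\<And>es. es \<in> E \<Longrightarrow> length es = d - j"
    and "\<And>es. es \<in> E \<Longrightarrow> c es \<noteq> 0"
  shows "(\<Sum>es\<in>E. Const (c es) * lprod t j es) \<notin> P j"
  using assms
proof (induction j arbitrary: E c rule: inc_induct)
  case base
  \<comment> \<open>At the top of the chain no \<open>t\<close> is left: the sum is a single nonzero
    constant, a unit, which a proper ideal cannot contain.\<close>
  have "E \<subseteq> {[]}" using base(3) by fastforce
  with base(2) have E: "E = {[]}" by blast
  show ?case
  proof
    assume "(\<Sum>es\<in>E. Const (c es) * lprod t d es) \<in> P d"
    then have "Const (c []) \<in> P d" by (simp add: E)
    then have "Const (inverse (c [])) * Const (c []) \<in> P d"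
      by (rule ideal_mult[OF ideal_P[OF order_refl] _ carrier_Const])
    then show False
      using base(4)[of "[]"] proper_P[of d] by (simp add: E Const_mult[symmetric])
  qed
next
  case (step j)
  define a0 where "a0 = Min (hd ` E)"
  define E0 where "E0 = {es \<in> E. hd es = a0}"
  have a0: "a0 \<le> hd es" if "es \<in> E" for es
    using step.prems(1) that by (simp add: a0_def)
  have "a0 \<in> hd ` E"
    unfolding a0_def using step.prems(1,2) by (intro Min_in) auto
  then have E0: "E0 \<noteq> {}" "finite E0" using step.prems(1) by (auto simp: E0_def)
  have cons: "es = hd es # tl es" "length (tl es) = d - Suc j" if "es \<in> E" for es
    using step.prems(3)[OF that] step.hyps by (cases es; simp)+
  note J = ideal_P[of "Suc j"]
  define q where "q es = Const (c es) * (t j ^ (hd es - a0) * lprod t (Suc j) (tl es))" for es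
  have lc: "lprod t (Suc j) (tl es) \<in> carrier (mpoly_ring V)" if "es \<in> E" for es
    using cons[OF that] step.hyps by (intro lprod_t_carrier) simp
  have tc: "t j \<in> carrier (mpoly_ring V)" using step.hyps by (intro t_carrier)
  have "Const (c es) * lprod t j es = t j ^ a0 * q es" if "es \<in> E" for es
  proof -
    have "lprod t j es = t j ^ hd es * lprod t (Suc j) (tl es)"
      by (subst cons(1)[OF that]) simp
    also have "t j ^ hd es = t j ^ a0 * t j ^ (hd es - a0)"
      using a0[OF that] by (simp flip: power_add)
    finally show ?thesis by (simp add: q_def ac_simps)
  qed
  then have sum_eq: "(\<Sum>es\<in>E. Const (c es) * lprod t j es) = t j ^ a0 * (\<Sum>es\<in>E. q es)"
    by (simp add: sum_distrib_left)
  have split: "(\<Sum>es\<in>E. q es) = (\<Sum>es\<in>E0. q es) + (\<Sum>es\<in>E - E0. q es)"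
    using step.prems(1) by (subst sum.subset_diff[of E0]) (auto simp: E0_def)
  \<comment> \<open>All lists in \<open>E0\<close> have head \<open>a0\<close>, so dropping the
    heads merges no two terms and the coefficients stay nonzero.\<close>
  have inj: "inj_on tl E0"
  proof (rule inj_onI)
    fix x y assume "x \<in> E0" "y \<in> E0" "tl x = tl y"
    then show "x = y" using cons(1)[of x] cons(1)[of y] by (simp add: E0_def)
  qed
  have sum0: "(\<Sum>es\<in>E0. q es) = (\<Sum>es\<in>tl ` E0. Const (c (a0 # es)) * lprod t (Suc j) es)"
    unfolding sum.reindex[OF inj]
  proof (rule sum.cong)
    fix es assume "es \<in> E0"
    then have es: "es \<in> E" "hd es = a0" by (auto simp: E0_def)
    then have "a0 # tl es = es" using cons(1)[of es] by simp
    then show "q es = ((\<lambda>es. Const (c (a0 # es)) * lprod t (Suc j) es) \<circ> tl) es"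
      using es by (simp add: q_def)
  qed simp
  have "(\<Sum>es\<in>tl ` E0. Const (c (a0 # es)) * lprod t (Suc j) es) \<notin> P (Suc j)"
  proof (rule step.IH)
    fix es assume "es \<in> tl ` E0"
    then obtain x where x: "x \<in> E" "hd x = a0" "es = tl x" by (auto simp: E0_def)
    then have "a0 # es = x" using cons(1)[of x] by simp
    then show "c (a0 # es) \<noteq> 0" using step.prems(4)[OF x(1)] by simp
    show "length es = d - Suc j" using cons(2)[OF x(1)] x by simp
  qed (use E0 in auto)
  \<comment> \<open>Outside \<open>E0\<close> the exponent exceeds \<open>a0\<close>, so a factor
    \<open>t j\<close>, which lies in \<open>P (Suc j)\<close>, remains after the
    cancellation.\<close>
  moreover have "(\<Sum>es\<in>E - E0. q es) \<in> P (Suc j)"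
  proof (rule ideal_sum[OF J])
    fix es assume "es \<in> E - E0"
    then have es: "es \<in> E" "hd es - a0 = Suc (hd es - a0 - 1)" using a0[of es] by (auto simp: E0_def)
    have "Const (c es) * (t j ^ (hd es - a0 - 1) * lprod t (Suc j) (tl es)) \<in> carrier (mpoly_ring V)"
      by (intro carrier_mult carrier_Const carrier_power tc lc[OF es(1)])
    then have "Const (c es) * (t j ^ (hd es - a0 - 1) * lprod t (Suc j) (tl es)) * t j \<in> P (Suc j)"
      using step.hyps by (intro ideal_mult[OF J t_in]) auto
    moreover have "q es = Const (c es) * (t j ^ (hd es - a0 - 1) * lprod t (Suc j) (tl es)) * t j"
      unfolding q_def by (subst es(2)) (simp only: power_Suc ac_simps)
    ultimately show "q es \<in> P (Suc j)" by simp
  qed (use step.hyps in simp)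
  moreover have "(\<Sum>es\<in>E. q es) \<in> P (Suc j)" if "t j ^ a0 * (\<Sum>es\<in>E. q es) \<in> P j"
  proof -
    have "(\<Sum>es\<in>E. q es) \<in> carrier (mpoly_ring V)"
      unfolding q_def by (intro carrier_sum carrier_mult carrier_Const carrier_power tc lc)
    then have "(\<Sum>es\<in>E. q es) \<in> P j"
      using prime_P[OF _ carrier_power[OF tc] _ that] power_notin[of j a0] step.hyps by auto
    then show ?thesis using mono_P[of j] step.hyps by auto
  qed
  ultimately show ?case
    using ideal_diff[OF J, of "\<Sum>es\<in>E. q es" "\<Sum>es\<in>E - E0. q es"] step.hyps
    unfolding sum_eq split sum0[symmetric] by auto
qed

end

subsection \<open>Linear forms generating an ideal of finite colength\<close>

text \<open>If \<open>w\<close> is injective its image is too large to be independent; otherwise two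
  equal values already give a relation.\<close>

lemma (in vector_space) relation_of_card:
  assumes "finite E" "finite W" "card W < card E" "\<And>x. x \<in> E \<Longrightarrow> w x \<in> span W"
  shows "\<exists>c. (\<exists>x\<in>E. c x \<noteq> 0) \<and> (\<Sum>x\<in>E. scale (c x) (w x)) = 0"
proof (cases "inj_on w E")
  case True
  have "dependent (w ` E)"
  proof (rule ccontr)
    assume "independent (w ` E)"
    then have "card (w ` E) \<le> card W"
      using independent_span_bound[OF assms(2), of "w ` E"] assms(4) by blast
    then show False using assms(3) card_image[OF True] by simp
  qed
  then obtain u where u: "\<exists>v\<in>w ` E. u v \<noteq> 0" "(\<Sum>v\<in>w ` E. scale (u v) v) = 0"
    using assms(1) by (auto simp: dependent_finite)
  then have "(\<Sum>x\<in>E. scale ((u \<circ> w) x) (w x)) = 0" "\<exists>x\<in>E. (u \<circ> w) x \<noteq> 0"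
    by (simp_all add: sum.reindex[OF True])
  then show ?thesis by blast
next
  case False
  then obtain x y where xy: "x \<in> E" "y \<in> E" "x \<noteq> y" "w x = w y" by (auto simp: inj_on_def)
  define c :: "_ \<Rightarrow> 'a" where "c z = (if z = x then 1 else if z = y then - 1 else 0)" for z
  have "(\<Sum>z\<in>E. scale (c z) (w z)) = (\<Sum>z\<in>{x, y}. scale (c z) (w z))"
    using xy assms(1) by (intro sum.mono_neutral_right) (auto simp: c_def)
  also have "\<dots> = 0" using xy by (simp add: c_def)
  finally show ?thesis using xy(1) by (intro exI[of _ c]) (auto simp: c_def)
qed

text \<open>Products of powers of the elements of \<open>B\<close> with module generators of degree
  below \<open>n0\<close>. Bounding each exponent separately, rather than their sum, makes the count
  a plain power of \<open>Suc N\<close>.\<close>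

definition red_gens :: "nat \<Rightarrow> (nat, 'k::field) mpol set \<Rightarrow> nat \<Rightarrow> nat \<Rightarrow> (nat, 'k) mpol set" where
  "red_gens m B n0 N =
     (\<lambda>(e, g). (\<Prod>b\<in>B. b ^ e b) * mon g) ` ((B \<rightarrow>\<^sub>E {..N}) \<times> (\<Union>i<n0. monomials {1..m} i))"

lemma red_gens_mono: "N \<le> N' \<Longrightarrow> red_gens m B n0 N \<subseteq> red_gens m B n0 N'"
  unfolding red_gens_def by (intro image_mono Sigma_mono PiE_mono) auto

lemma finite_red_gens:
  assumes "finite B"
  shows "finite (red_gens m B n0 N)"
    and "card (red_gens m B n0 N) \<le> Suc N ^ card B * card (\<Union>i<n0. monomials {1..m} i)"
proof -
  have fin: "finite ((B \<rightarrow>\<^sub>E {..N}) \<times> (\<Union>i<n0. monomials {1..m} i))"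
    by (intro finite_cartesian_product finite_PiE finite_UN_I finite_monomials assms) auto
  then show "finite (red_gens m B n0 N)" unfolding red_gens_def by (rule finite_imageI)
  have "card (red_gens m B n0 N) \<le> card ((B \<rightarrow>\<^sub>E {..N}) \<times> (\<Union>i<n0. monomials {1..m} i))"
    unfolding red_gens_def by (rule card_image_le[OF fin])
  also have "\<dots> = Suc N ^ card B * card (\<Union>i<n0. monomials {1..m} i)"
    by (simp only: card_cartesian_product card_PiE[OF assms] card_atMost prod_constant)
  finally show "card (red_gens m B n0 N) \<le> Suc N ^ card B * card (\<Union>i<n0. monomials {1..m} i)" .
qed

lemma mult_red_gens:
  assumes "finite B" "b \<in> B" "x \<in> red_gens m B n0 N"
  shows "b * x \<in> red_gens m B n0 (Suc N)"
proof -
  obtain e g where e: "e \<in> B \<rightarrow>\<^sub>E {..N}" "g \<in> (\<Union>i<n0. monomials {1..m} i)"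
    "x = (\<Prod>b\<in>B. b ^ e b) * mon g"
    using assms(3) unfolding red_gens_def by auto
  define e' where "e' = e(b := Suc (e b))"
  have "e' \<in> B \<rightarrow>\<^sub>E {..Suc N}"
    using e(1) assms(2) by (auto simp: e'_def PiE_iff extensional_def le_Suc_eq)
  moreover have "(\<Prod>b\<in>B. b ^ e' b) = b * (\<Prod>b\<in>B. b ^ e b)"
  proof -
    have "(\<Prod>b\<in>B. b ^ e' b) = b ^ e' b * (\<Prod>b\<in>B - {b}. b ^ e' b)"
      by (rule prod.remove[OF assms(1,2)])
    also have "(\<Prod>b\<in>B - {b}. b ^ e' b) = (\<Prod>b\<in>B - {b}. b ^ e b)"
      by (rule prod.cong) (auto simp: e'_def)
    also have "b ^ e' b * \<dots> = b * (b ^ e b * (\<Prod>b\<in>B - {b}. b ^ e b))"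
      by (simp add: e'_def mult.assoc)
    also have "b ^ e b * (\<Prod>b\<in>B - {b}. b ^ e b) = (\<Prod>b\<in>B. b ^ e b)"
      by (rule prod.remove[OF assms(1,2), symmetric])
    finally show ?thesis .
  qed
  ultimately show ?thesis
    unfolding red_gens_def e(3) using e(2)
    by (intro image_eqI[of _ _ "(e', g)"]) (simp_all add: mult.assoc)
qed

text \<open>A graded Nakayama argument. From degree \<open>n0\<close> on, a form is a combination of
  products \<open>b * mon g\<close> with \<open>g\<close> one degree lower, up to an element of
  \<open>I\<close>; induction on the degree stops below \<open>n0\<close>. Since \<open>n0\<close>
  is positive, a lower degree always exists.\<close>

lemma mon_in_span_red_gens:
  fixes Y :: "(nat \<times> (nat, 'k::field) mpol) set"
  assumes B: "finite B" "\<And>b. b \<in> B \<Longrightarrow> form {1..m} 1 b"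
    and Y: "\<And>\<delta> x. (\<delta>, x) \<in> Y \<Longrightarrow> form {1..m} \<delta> x"
    and I: "I = Idl\<^bsub>xring m\<^esub> (snd ` Y)"
    and n0: "n0 \<ge> 1" "\<And>n. n \<ge> n0 \<Longrightarrow> {p. form {1..m} n p} \<subseteq> Idl\<^bsub>xring m\<^esub> (B \<union> snd ` Y)"
    and e: "e \<in> monomials {1..m} n"
  shows "mon e \<in> mp.span (red_gens m B n0 n \<union> I)"
  using e
proof (induction n arbitrary: e rule: less_induct)
  case (less n)
  show ?case
  proof (cases "n < n0")
    case True
    \<comment> \<open>All exponents are zero; the restriction to \<open>B\<close> supplies the
      default value elsewhere that \<open>\<rightarrow>\<^sub>E\<close> demands.\<close>
    define e0 :: "(nat, 'k) mpol \<Rightarrow> nat" where "e0 = (\<lambda>b\<in>B. 0)"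
    have "(\<Prod>b\<in>B. b ^ e0 b) * mon e = mon e"
      by (simp add: e0_def)
    moreover have "(e0, e) \<in> (B \<rightarrow>\<^sub>E {..n}) \<times> (\<Union>i<n0. monomials {1..m} i)"
      using True less.prems by (auto simp: e0_def)
    ultimately have "mon e \<in> red_gens m B n0 n"
      unfolding red_gens_def by (intro image_eqI[of _ _ "(e0, e)"]) simp_all
    then show ?thesis by (intro mp.span_base) simp
  next
    case False
    then have n: "n0 \<le> n" "1 \<le> n" using n0(1) by simp_all
    have cY: "snd ` Y \<subseteq> carrier (xring m)"
      by (rule snd_forms_carrier) (rule Y)
    note idealI = Idl_ideal[OF cY, folded I]
    define Y' where "Y' = (\<lambda>b. (1, b)) ` B \<union> Y"
    have Y': "form {1..m} \<delta> x" if "(\<delta>, x) \<in> Y'" for \<delta> x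
      using that B(2) Y by (auto simp: Y'_def)
    have "snd ` Y' = B \<union> snd ` Y" by (simp add: Y'_def image_Un image_image)
    then have "{p. form {1..m} n p} \<subseteq> Idl\<^bsub>xring m\<^esub> (snd ` Y')"
      using n0(2)[OF n(1)] by simp
    then have "{p. form {1..m} n p} \<subseteq> mp.span (gens {1..m} Y' n)"
      using forms_subset_Idl_iff[of Y' "{1..m}" n, OF Y'] by simp
    then have "mon e \<in> mp.span (gens {1..m} Y' n)"
      using form_mon[OF less.prems] by blast
    moreover have "gens {1..m} Y' n \<subseteq> mp.span (red_gens m B n0 n \<union> I)"
    proof
      fix y assume "y \<in> gens {1..m} Y' n"
      then obtain \<delta> x g where y: "y = x * mon g" "(\<delta>, x) \<in> Y'" "\<delta> \<le> n"
        "g \<in> monomials {1..m} (n - \<delta>)" unfolding gens_def by blast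
      from y(2) consider "\<delta> = 1" "x \<in> B" | "(\<delta>, x) \<in> Y" by (auto simp: Y'_def)
      then show "y \<in> mp.span (red_gens m B n0 n \<union> I)"
      proof cases
        case 1
        have x: "x \<in> carrier (xring m)" using B(2)[OF 1(2)] by (rule carrier_form)
        have "mon g \<in> mp.span (red_gens m B n0 (n - 1) \<union> I)"
          using y(4) n 1 by (intro less.IH) simp_all
        then have "x * mon g \<in> mp.span (red_gens m B n0 n \<union> I)"
        proof (induction rule: mp.span_induct_alt)
          case (step c z w)
          have "x * z \<in> red_gens m B n0 n \<union> I"
            using step(1)
          proof
            assume "z \<in> red_gens m B n0 (n - 1)"
            then have "x * z \<in> red_gens m B n0 (Suc (n - 1))" by (rule mult_red_gens[OF B(1) 1(2)])
            then show ?thesis using n by simp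
          next
            assume "z \<in> I"
            then show ?thesis using ideal_mult[OF idealI _ x] by simp
          qed
          then have "Const c * (x * z) + x * w \<in> mp.span (red_gens m B n0 n \<union> I)"
            by (intro mp.span_add mp.span_scale mp.span_base step(2))
          then show ?case by (simp only: algebra_simps)
        qed (simp add: mp.span_zero)
        then show ?thesis unfolding y(1) .
      next
        case 2
        have "x \<in> snd ` Y" using 2 by (rule rev_image_eqI) simp
        then have "x \<in> I" unfolding I by (rule subsetD[OF Idl_incl[OF cY]])
        then have "y \<in> I"
          unfolding y(1) by (rule ideal_mult2[OF idealI]) (rule carrier_form[OF form_mon[OF y(4)]])
        then show ?thesis by (intro mp.span_base) simp
      qed
    qed
    ultimately show ?thesis
      using mp.span_minimal[OF _ mp.subspace_span] by blast
  qed
qed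

section \<open>Degree bounds and polynomial growth\<close>

definition deg_le :: "nat \<Rightarrow> ('v, 'c::comm_ring_1) mpol \<Rightarrow> bool" where
  "deg_le N p \<longleftrightarrow> (\<forall>e\<in>Poly_Mapping.keys p. mdeg e \<le> N)"

lemma deg_le_mult: "deg_le N p \<Longrightarrow> deg_le K q \<Longrightarrow> deg_le (N + K) (p * q)"
  unfolding deg_le_def using keys_mult[of p q] by (fastforce simp: mdeg_add intro: add_mono)

lemma deg_le_1 [simp]: "deg_le N 1"
  by (simp add: deg_le_def)

lemma deg_le_power: "deg_le N p \<Longrightarrow> deg_le (a * N) (p ^ a)"
  by (induction a) (simp_all add: deg_le_mult)

lemma deg_le_mono: "deg_le N p \<Longrightarrow> N \<le> K \<Longrightarrow> deg_le K p"
  by (auto simp: deg_le_def)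

lemma deg_le_exists: "\<exists>N. deg_le N p"
  unfolding deg_le_def by (intro exI[of _ "Max (insert 0 (mdeg ` Poly_Mapping.keys p))"]) simp

lemma deg_le_lprod:
  "(\<And>i. j \<le> i \<Longrightarrow> i < j + length es \<Longrightarrow> deg_le D (t i)) \<Longrightarrow> deg_le (sum_list es * D) (lprod t j es)"
proof (induction es arbitrary: j)
  case (Cons a es)
  have "deg_le D (t j)" by (rule Cons.prems) simp_all
  moreover have "deg_le (sum_list es * D) (lprod t (Suc j) es)"
    by (rule Cons.IH) (rule Cons.prems; simp)
  ultimately show ?case by (simp add: deg_le_mult deg_le_power distrib_right)
qed simp

text \<open>The left side grows in \<open>s\<close> like a polynomial of degree \<open>r\<close>,
  smaller than \<open>d\<close>.\<close>

lemma less_power_bound: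
  fixes r d K C :: nat
  assumes "r < d"
  obtains s where "Suc (K * s) ^ r * C < s ^ d"
proof
  \<comment> \<open>Bounding \<open>Suc (K * s)\<close> by \<open>Suc K * s\<close> and splitting
    off \<open>s ^ r\<close> leaves the constant \<open>Suc K ^ r * C\<close>, which
    \<open>s\<close> has to exceed.\<close>
  define s where "s = Suc K ^ r * C + 1"
  have s: "1 \<le> s" by (simp add: s_def)
  then have "Suc (K * s) \<le> Suc K * s" by simp
  then have "Suc (K * s) ^ r * C \<le> (Suc K * s) ^ r * C"
    by (intro mult_right_mono power_mono) auto
  also have "\<dots> = s ^ r * (Suc K ^ r * C)"
    by (simp only: power_mult_distrib ac_simps)
  also have "\<dots> < s ^ r * s"
    using s by (intro mult_strict_left_mono) (simp_all add: s_def)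
  also have "\<dots> = s ^ Suc r" by simp
  also have "\<dots> \<le> s ^ d" using assms s by (intro power_increasing) auto
  finally show "Suc (K * s) ^ r * C < s ^ d" .
qed

lemma sum_list_bound: "set es \<subseteq> {..<s} \<Longrightarrow> sum_list es \<le> length es * (s :: nat)"
  by (induction es) auto

text \<open>A special case of the dimension theorem: if \<open>R/I\<close> is finite over the algebra generated by
  fewer than \<open>d\<close> linear forms, then the monomials in \<open>d\<close> polynomials grow faster than the
  dimension of the space containing them, which gives the relation excluded by
  \<open>no_relation\<close>.\<close>

lemma no_prime_chain:
  fixes Y :: "(nat \<times> (nat, 'k::field) mpol) set"
  assumes B: "finite B" "\<And>b. b \<in> B \<Longrightarrow> form {1..m} 1 b" "card B < d"
    and Y: "\<And>\<delta> x. (\<delta>, x) \<in> Y \<Longrightarrow> form {1..m} \<delta> x"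
    and n0: "\<And>n. n \<ge> n0 \<Longrightarrow> {p. form {1..m} n p} \<subseteq> Idl\<^bsub>xring m\<^esub> (B \<union> snd ` Y)"
    and chain: "prime_chain {1..m} P d t"
    and P0: "Idl\<^bsub>xring m\<^esub> (snd ` Y) \<subseteq> P 0"
  shows False
proof -
  interpret prime_chain "{1..m}" P d t by (rule chain)
  define I where "I = Idl\<^bsub>xring m\<^esub> (snd ` Y)"
  have idealI: "ideal I (xring m)"
    unfolding I_def by (rule Idl_ideal, rule snd_forms_carrier) (rule Y)
  \<comment> \<open>\<open>Suc n0\<close> provides the positive threshold that
    \<open>mon_in_span_red_gens\<close> asks for.\<close>
  define W where "W = red_gens m B (Suc n0)"
  have n0S: "{p. form {1..m} n p} \<subseteq> Idl\<^bsub>xring m\<^esub> (B \<union> snd ` Y)" if "Suc n0 \<le> n" for n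
    using that by (intro n0) simp
  have span: "p \<in> mp.span (W N \<union> I)" if p: "p \<in> carrier (xring m)" "deg_le N p" for p N
  proof -
    have "mon e \<in> mp.span (W N \<union> I)" if "e \<in> Poly_Mapping.keys p" for e
    proof -
      have e: "e \<in> monomials {1..m} (mdeg e)"
        using p(1) that by (simp add: carrier_mpoly_ring monomials_def)
      have "mon e \<in> mp.span (W (mdeg e) \<union> I)"
        unfolding W_def
        by (rule mon_in_span_red_gens[OF B(1) B(2) Y I_def _ n0S e]) (assumption | simp)+
      moreover have "W (mdeg e) \<subseteq> W N"
        unfolding W_def using p(2) that by (intro red_gens_mono) (simp add: deg_le_def)
      ultimately show ?thesis
        using mp.span_mono[of "W (mdeg e) \<union> I" "W N \<union> I"] by blast
    qed
    then have "(\<Sum>e\<in>Poly_Mapping.keys p. Const (Poly_Mapping.lookup p e) * mon e) \<in> mp.span (W N \<union> I)"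
      by (intro mp.span_sum mp.span_scale)
    then show ?thesis using mpol_eq_sum_single[of p] by (simp add: Const_mult_mon)
  qed
  obtain D where D: "\<And>i. i < d \<Longrightarrow> deg_le D (t i)"
  proof -
    have "\<forall>i. \<exists>N. deg_le N (t i)" by (simp add: deg_le_exists)
    then obtain N where N: "\<forall>i. deg_le (N i) (t i)" by metis
    have "deg_le (\<Sum>i<d. N i) (t i)" if "i < d" for i
      using that by (intro deg_le_mono[OF N[rule_format]] member_le_sum) auto
    then show thesis by (rule that)
  qed
  \<comment> \<open>With exponents below \<open>s\<close> and \<open>t i\<close> of degree at most
    \<open>D\<close>, a product of \<open>d\<close> powers has degree at most
    \<open>d * D * s\<close>; this \<open>s\<close> makes the \<open>s ^ d\<close> exponent lists
    outnumber the elements of \<open>W\<close> for that degree.\<close>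
  obtain s where s: "Suc (d * D * s) ^ card B * card (\<Union>i<Suc n0. monomials {1..m} i) < s ^ d"
    by (rule less_power_bound[OF B(3)])
  define E where "E = {es. set es \<subseteq> {..<s} \<and> length es = d}"
  have finE: "finite E" and cardE: "card E = s ^ d"
    unfolding E_def by (simp_all add: finite_lists_length_eq card_lists_length_eq)
  \<comment> \<open>The span of \<open>W\<close> and \<open>I\<close> together has no useful
    dimension bound; a representative modulo \<open>I\<close> within the span of \<open>W\<close>
    does.\<close>
  have "\<exists>w. w \<in> mp.span (W (d * D * s)) \<and> lprod t 0 es - w \<in> I" if "es \<in> E" for es
  proof -
    have es: "set es \<subseteq> {..<s}" "length es = d" using that by (auto simp: E_def)
    have "sum_list es * D \<le> d * D * s"
      using mult_right_mono[OF sum_list_bound[OF es(1)], of D] by (simp add: es(2) ac_simps)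
    moreover have "deg_le (sum_list es * D) (lprod t 0 es)"
      by (rule deg_le_lprod) (simp add: D es)
    ultimately have "deg_le (d * D * s) (lprod t 0 es)" by (rule deg_le_mono[rotated])
    then have "lprod t 0 es \<in> mp.span (W (d * D * s) \<union> I)"
      using es by (intro span lprod_t_carrier) simp_all
    then obtain w i where "w \<in> mp.span (W (d * D * s))" "i \<in> mp.span I" "lprod t 0 es = w + i"
      unfolding mp.span_Un by blast
    moreover have "mp.span I = I" using ideal_subspace[OF idealI] by (simp add: mp.span_eq_iff)
    ultimately show ?thesis by auto
  qed
  then obtain w where w: "\<And>es. es \<in> E \<Longrightarrow> w es \<in> mp.span (W (d * D * s))"
    "\<And>es. es \<in> E \<Longrightarrow> lprod t 0 es - w es \<in> I" by metis
  have fW: "finite (W N)" for N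
    unfolding W_def by (rule finite_red_gens(1)[OF B(1)])
  have cW: "card (W (d * D * s)) < card E"
    using finite_red_gens(2)[OF B(1), of m "Suc n0" "d * D * s"] s unfolding W_def cardE by simp
  have "\<exists>c. (\<exists>es\<in>E. c es \<noteq> 0) \<and> (\<Sum>es\<in>E. Const (c es) * w es) = 0"
    by (rule mp.relation_of_card[OF finE fW cW]) (rule w(1))
  then obtain c where c: "\<exists>es\<in>E. c es \<noteq> 0" "(\<Sum>es\<in>E. Const (c es) * w es) = 0"
    by blast
  \<comment> \<open>The representatives differ from the products by elements of \<open>I\<close>, so
    their relation becomes one of the products modulo \<open>I\<close>.\<close>
  have "(\<Sum>es\<in>E. Const (c es) * (lprod t 0 es - w es)) \<in> I"
    by (intro ideal_sum[OF idealI] ideal_mult[OF idealI] w(2) carrier_Const)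
  then have "(\<Sum>es\<in>E. Const (c es) * lprod t 0 es) \<in> I"
    using c(2) by (simp add: right_diff_distrib sum_subtractf)
  also have "(\<Sum>es\<in>E. Const (c es) * lprod t 0 es)
      = (\<Sum>es\<in>{es \<in> E. c es \<noteq> 0}. Const (c es) * lprod t 0 es)"
    using finE by (intro sum.mono_neutral_right) auto
  finally have "(\<Sum>es\<in>{es \<in> E. c es \<noteq> 0}. Const (c es) * lprod t 0 es) \<in> P 0"
    using P0 unfolding I_def by blast
  moreover have "(\<Sum>es\<in>{es \<in> E. c es \<noteq> 0}. Const (c es) * lprod t 0 es) \<notin> P 0"
  proof (rule no_relation)
    show "finite {es \<in> E. c es \<noteq> 0}" using finE by simp
  qed (use c(1) in \<open>auto simp: E_def\<close>)
  ultimately show False by blast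
qed

subsection \<open>Quotient rings\<close>

context ring
begin

text \<open>An ideal containing \<open>I\<close> is a union of cosets of \<open>I\<close>, so
  membership may be tested on either side of the projection.\<close>

lemma coset_in_image_iff:
  assumes "ideal I R" "ideal K R" "I \<subseteq> K" "p \<in> carrier R"
  shows "I +> p \<in> (+>) I ` K \<longleftrightarrow> p \<in> K"
proof -
  have "K = \<Union> ((+>) I ` K)" using ideal_incl_iff[OF assms(1,2)] assms(3) by simp
  moreover have "(+>) I ` K \<subseteq> carrier (R Quot I)"
    using ideal.Icarr[OF ring_ideal_imp_quot_ideal[OF assms(1,2)]] by blast
  ultimately show ?thesis
    using canonical_proj_vimage_mem_iff[OF assms(1) _ assms(4), of "(+>) I ` K"] by simp
qed

lemma quot_ideal_obtain:
  assumes "ideal I R" "ideal J (R Quot I)"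
  obtains K where "ideal K R" "I \<subseteq> K" "J = (+>) I ` K"
proof -
  have "J \<in> (\<lambda>K. (+>) I ` K) ` {K. ideal K R \<and> I \<subseteq> K}"
    using quot_ideal_correspondence[OF assms(1)] assms(2) by (simp add: bij_betw_def)
  then show ?thesis using that by blast
qed

lemma coset_carrier: "p \<in> carrier R \<Longrightarrow> I +> p \<in> carrier (R Quot I)"
  by (auto simp: FactRing_def A_RCOSETS_defs a_r_coset_def)

lemma quot_carrier_obtain:
  assumes "x \<in> carrier (R Quot I)"
  obtains p where "p \<in> carrier R" "x = I +> p"
  using assms by (auto simp: FactRing_def A_RCOSETS_defs a_r_coset_def)

text \<open>For the harder inclusion, the left side is the image of some ideal above
  \<open>I\<close>, which has to contain \<open>X\<close>.\<close>

lemma Idl_quot: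
  assumes I: "ideal I R" and X: "X \<subseteq> carrier R"
  shows "Idl\<^bsub>R Quot I\<^esub> ((+>) I ` X) = (+>) I ` (Idl\<^bsub>R\<^esub> (X \<union> I))"
proof
  interpret Q: ring "R Quot I" by (rule ideal.quotient_is_ring[OF I])
  have XI: "X \<union> I \<subseteq> carrier R"
    using X ideal.Icarr[OF I] by blast
  have QX: "(+>) I ` X \<subseteq> carrier (R Quot I)" using X coset_carrier by blast
  show "Idl\<^bsub>R Quot I\<^esub> ((+>) I ` X) \<subseteq> (+>) I ` (Idl\<^bsub>R\<^esub> (X \<union> I))"
    using genideal_self[OF XI]
    by (intro Q.genideal_minimal ring_ideal_imp_quot_ideal[OF I genideal_ideal[OF XI]]) blast
  obtain K where K: "ideal K R" "I \<subseteq> K" "Idl\<^bsub>R Quot I\<^esub> ((+>) I ` X) = (+>) I ` K"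
    by (rule quot_ideal_obtain[OF I Q.genideal_ideal[OF QX]])
  have "X \<subseteq> K"
  proof
    fix x assume x: "x \<in> X"
    then have "I +> x \<in> (+>) I ` K" using Q.genideal_self[OF QX] K(3) by blast
    then show "x \<in> K" using coset_in_image_iff[OF I K(1,2)] X x by blast
  qed
  then have "Idl\<^bsub>R\<^esub> (X \<union> I) \<subseteq> K" using K(2) by (intro genideal_minimal[OF K(1)]) simp
  then show "(+>) I ` (Idl\<^bsub>R\<^esub> (X \<union> I)) \<subseteq> Idl\<^bsub>R Quot I\<^esub> ((+>) I ` X)"
    unfolding K(3) by blast
qed

end

lemma krull_dim_chain:
  assumes "krull_dim A = enat d" "d \<noteq> 0"
  obtains P where "\<forall>i\<le>d. primeideal (P i) A" "\<forall>i<d. P i \<subset> P (Suc i)"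
proof -
  define X where "X = {enat n | n. \<exists>P. (\<forall>i\<le>n. primeideal (P i) A) \<and> (\<forall>i<n. P i \<subset> P (Suc i))}"
  have S: "Sup X = enat d" using assms(1) by (simp add: krull_dim_def X_def)
  \<comment> \<open>The empty set also has supremum 0, so \<open>d \<noteq> 0\<close> is what makes
    \<open>X\<close> nonempty; a finite supremum of a nonempty set is attained.\<close>
  with assms(2) have "X \<noteq> {}" "finite X" "Max X = enat d"
    by (auto simp: Sup_enat_def zero_enat_def split: if_splits)
  then have "enat d \<in> X" using Max_in by metis
  then obtain P where "\<forall>i\<le>d. primeideal (P i) A" "\<forall>i<d. P i \<subset> P (Suc i)"
    unfolding X_def by blast
  then show ?thesis using that by blast
qed

text \<open>Primes are pulled back along the projection; since it is onto, elements separating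
  neighbouring primes lift to the \<open>t i\<close>.\<close>

lemma prime_chain_of_krull_dim:
  fixes I :: "('v, 'k::field) mpol set"
  assumes I: "ideal I (mpoly_ring V)"
    and dim: "krull_dim (mpoly_ring V Quot I) = enat d" "d \<noteq> 0"
  obtains P t where "prime_chain V P d t" "I \<subseteq> P 0"
proof -
  let ?R = "mpoly_ring V :: ('v, 'k) mpol ring"
  interpret R: cring ?R by (rule cring_mpoly_ring)
  interpret h: ring_hom_ring ?R "?R Quot I" "(+>\<^bsub>?R\<^esub>) I"
    by (rule ideal.rcos_ring_hom_ring[OF I])
  obtain P where chain: "\<forall>i\<le>d. primeideal (P i) (?R Quot I)" "\<forall>i<d. P i \<subset> P (Suc i)"
    by (rule krull_dim_chain[OF dim])
  note P = chain(1)[rule_format] chain(2)[rule_format]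
  define P' where "P' i = {r \<in> carrier ?R. I +>\<^bsub>?R\<^esub> r \<in> P i}" for i
  have pr: "primeideal (P' i) ?R" if "i \<le> d" for i
    unfolding P'_def by (rule h.primeideal_vimage[OF cring_mpoly_ring P(1)[OF that]])
  have "\<exists>r. r \<in> P' (Suc i) \<and> r \<notin> P' i" if i: "i < d" for i
  proof -
    obtain x where x: "x \<in> P (Suc i)" "x \<notin> P i" using P(2)[OF i] by blast
    have "x \<in> carrier (?R Quot I)"
      using x(1) i by (intro ideal.Icarr[OF primeideal.axioms(1)[OF P(1)]]) auto
    then obtain p where "p \<in> carrier ?R" "x = I +>\<^bsub>?R\<^esub> p" by (rule R.quot_carrier_obtain)
    then show ?thesis using x by (auto simp: P'_def)
  qed
  then obtain t where t: "\<And>i. i < d \<Longrightarrow> t i \<in> P' (Suc i) \<and> t i \<notin> P' i" by metis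
  have id: "ideal (P' i) ?R" if "i \<le> d" for i
    using primeideal.axioms(1)[OF pr[OF that]] .
  have "prime_chain V P' d t"
  proof (rule prime_chain.intro)
    fix i assume i: "i \<le> d"
    show "ideal (P' i) ?R" by (rule id[OF i])
    show "1 \<notin> P' i"
    proof
      assume "1 \<in> P' i"
      then have "P' i = carrier ?R" using ideal.one_imp_carrier[OF id[OF i]] by simp
      then show False using primeideal.I_notcarr[OF pr[OF i]] by simp
    qed
    fix p q assume "p \<in> carrier ?R" "q \<in> carrier ?R" "p * q \<in> P' i"
    then show "p \<in> P' i \<or> q \<in> P' i" using primeideal.I_prime[OF pr[OF i], of p q] by simp
  next
    fix i assume i: "i < d"
    show "P' i \<subseteq> P' (Suc i)" using P(2)[OF i] by (auto simp: P'_def)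
    show "t i \<in> P' (Suc i)" "t i \<notin> P' i" using t[OF i] by simp_all
  qed
  moreover have "I \<subseteq> P' 0"
  proof
    fix p assume p: "p \<in> I"
    have c: "p \<in> carrier ?R" by (rule ideal_carrierD[OF I p])
    have "I +>\<^bsub>?R\<^esub> p = I +>\<^bsub>?R\<^esub> 0"
      using R.a_rcos_zero[OF I p] R.a_rcos_zero[OF I ideal_0[OF I]] by simp
    then have "I +>\<^bsub>?R\<^esub> p \<in> P 0"
      using ideal_0[OF id[of 0]] by (simp add: P'_def)
    then show "p \<in> P' 0" using c by (simp add: P'_def)
  qed
  ultimately show ?thesis by (rule that)
qed

subsection \<open>Reductions\<close>

lemma gens_xgens:
  assumes f: "\<forall>j\<in>{1..v}. form {1..m} (dg j) (f j)"
    and I: "I = Idl\<^bsub>xring m\<^esub> (f ` {1..v})"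
    and y: "y \<in> gens {1..m} (xgens m d v f dg a) n"
  shows "y \<in> I \<or> (\<exists>i\<in>{1..d}. \<exists>g. y = lin_form m a i * mon g \<and> 1 \<le> n \<and> g \<in> monomials {1..m} (n - 1))"
proof -
  have fc: "f ` {1..v} \<subseteq> carrier (xring m)"
    by (rule image_subsetI) (rule carrier_form[OF f[rule_format]])
  obtain \<delta> x g where *: "y = x * mon g" "(\<delta>, x) \<in> xgens m d v f dg a" "\<delta> \<le> n"
    "g \<in> monomials {1..m} (n - \<delta>)" using y unfolding gens_def by blast
  from *(2) consider i where "i \<in> {1..d}" "\<delta> = 1" "x = lin_form m a i" | j where "j \<in> {1..v}" "x = f j"
    unfolding xgens_def by blast
  then show ?thesis
  proof cases
    case 1
    then show ?thesis using * by blast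
  next
    case 2
    have "f j \<in> I" unfolding I using 2(1) by (intro subsetD[OF Idl_incl[OF fc]] imageI)
    then have "y \<in> I"
      unfolding *(1) 2(2) I
      by (rule ideal_mult2[OF Idl_ideal[OF fc]]) (rule carrier_form[OF form_mon[OF *(4)]])
    then show ?thesis ..
  qed
qed

context
  fixes m d v :: nat and I :: "(nat, 'k::field) mpol set"
    and f :: "nat \<Rightarrow> (nat, 'k) mpol" and dg :: "nat \<Rightarrow> nat"
  assumes f: "\<forall>j\<in>{1..v}. form {1..m} (dg j) (f j)"
    and I: "I = Idl\<^bsub>xring m\<^esub> (f ` {1..v})"
begin

interpretation R: cring "xring m" by (rule cring_mpoly_ring)

text \<open>The preimage in \<open>R\<close> of the ideal of \<open>A\<close> parameterized by
  \<open>a\<close>.\<close>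

abbreviation fibre :: "(nat \<times> nat \<Rightarrow> 'k) \<Rightarrow> (nat, 'k) mpol set" where
  "fibre a \<equiv> Idl\<^bsub>xring m\<^esub> (lin_form m a ` {1..d} \<union> I)"

lemma f_carrier: "f ` {1..v} \<subseteq> carrier (xring m)"
  by (rule image_subsetI) (rule carrier_form[OF f[rule_format]])

lemma ideal_I: "ideal I (xring m)"
  unfolding I by (rule Idl_ideal[OF f_carrier])

lemma Un_I_carrier: "X \<subseteq> carrier (xring m) \<Longrightarrow> X \<union> I \<subseteq> carrier (xring m)"
  using ideal_carrierD[OF ideal_I] by blast

lemma lin_forms_carrier: "lin_form m a ` {1..d} \<subseteq> carrier (xring m)"
  by (rule image_subsetI) (rule lin_form_carrier)

lemma ideal_fibre: "ideal (fibre a) (xring m)"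
  by (rule Idl_ideal[OF Un_I_carrier[OF lin_forms_carrier]])

lemma I_fibre: "I \<subseteq> fibre a"
  using Idl_incl[OF Un_I_carrier[OF lin_forms_carrier]] by blast

lemma hcomp_fibre:
  assumes "p \<in> fibre a"
  shows "hcomp n p \<in> mp.span (gens {1..m} (xgens m d v f dg a) n)"
proof (rule hcomp_Idl_forms)
  have "fibre a = Idl\<^bsub>xring m\<^esub> (snd ` xgens m d v f dg a)"
    unfolding xgens_def I image_Un image_image snd_conv
    by (rule Idl_Un_Idl[OF lin_forms_carrier f_carrier])
  with assms show "p \<in> Idl\<^bsub>xring m\<^esub> (snd ` xgens m d v f dg a)" by simp
qed (rule form_xgens[OF f])

text \<open>Linear forms contribute nothing in degree 0, so 1 would already lie in
  \<open>I\<close>.\<close>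

lemma forms_0_not_in_fibre:
  assumes "I \<noteq> carrier (xring m)"
  shows "\<not> {p. form {1..m} 0 p} \<subseteq> fibre a"
proof
  assume "{p. form {1..m} 0 p} \<subseteq> fibre a"
  moreover have one: "form {1..m} 0 (1 :: (nat, 'k) mpol)"
    using form_Const[of "{1..m}" "1 :: 'k"] by simp
  ultimately have "hcomp 0 1 \<in> mp.span (gens {1..m} (xgens m d v f dg a) 0)"
    by (intro hcomp_fibre) blast
  moreover have "gens {1..m} (xgens m d v f dg a) 0 \<subseteq> I"
    using gens_xgens[OF f I, of _ d a 0] by force
  then have "mp.span (gens {1..m} (xgens m d v f dg a) 0) \<subseteq> I"
    by (rule mp.span_minimal[OF _ ideal_subspace[OF ideal_I]])
  ultimately have "1 \<in> I" using form_hcomp[OF one, of 0] by auto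
  then show False using ideal.one_imp_carrier[OF ideal_I] assms by simp
qed

text \<open>In degree 1 each \<open>y_i\<close> can only be multiplied by the monomial 1. This
  confines the generators of a smaller reduction to the span of the \<open>y_i\<close> modulo
  \<open>I\<close>.\<close>

lemma linear_in_fibre:
  assumes "form {1..m} 1 p" "p \<in> fibre a"
  obtains q i where "q \<in> mp.span (lin_form m a ` {1..d})" "i \<in> I" "p = q + i"
proof -
  have "gens {1..m} (xgens m d v f dg a) 1 \<subseteq> lin_form m a ` {1..d} \<union> I"
  proof
    fix y assume "y \<in> gens {1..m} (xgens m d v f dg a) 1"
    then consider "y \<in> I" | i g where "i \<in> {1..d}" "y = lin_form m a i * mon g" "g \<in> monomials {1..m} (1 - 1)"
      using gens_xgens[OF f I, of y d a 1] by blast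
    then show "y \<in> lin_form m a ` {1..d} \<union> I"
    proof cases
      case 2
      then have "g = 0" by (simp add: monomials_def mdeg_eq_0_iff)
      with 2 show ?thesis by simp
    qed simp
  qed
  then have "mp.span (gens {1..m} (xgens m d v f dg a) 1) \<subseteq> mp.span (lin_form m a ` {1..d} \<union> I)"
    by (rule mp.span_mono)
  moreover have "p \<in> mp.span (gens {1..m} (xgens m d v f dg a) 1)"
    using hcomp_fibre[OF assms(2), of 1] form_hcomp[OF assms(1), of 1] by simp
  ultimately have "p \<in> mp.span (lin_form m a ` {1..d} \<union> I)" by blast
  then obtain q i where "q \<in> mp.span (lin_form m a ` {1..d})" "i \<in> mp.span I" "p = q + i"
    unfolding mp.span_Un by blast
  moreover have "mp.span I = I"
    using ideal_subspace[OF ideal_I] by (simp add: mp.span_eq_iff)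
  ultimately show ?thesis using that by simp
qed

lemma quot_comp_subset_iff:
  assumes "ideal K (xring m)" "I \<subseteq> K"
  shows "quot_comp m I n \<subseteq> (+>\<^bsub>xring m\<^esub>) I ` K \<longleftrightarrow> {p. form {1..m} n p} \<subseteq> K"
proof -
  have "I +>\<^bsub>xring m\<^esub> p \<in> (+>\<^bsub>xring m\<^esub>) I ` K \<longleftrightarrow> p \<in> K" if "form {1..m} n p" for p
    by (rule R.coset_in_image_iff[OF ideal_I assms carrier_form[OF that]])
  then show ?thesis unfolding quot_comp_def by blast
qed

lemma quot_comp_Int_iff:
  assumes "ideal K (xring m)" "I \<subseteq> K"
  shows "(+>\<^bsub>xring m\<^esub>) I ` K \<inter> quot_comp m I n = quot_comp m I n \<longleftrightarrow> {p. form {1..m} n p} \<subseteq> K"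
  using quot_comp_subset_iff[OF assms, of n] by blast

lemma param_ideal_eq: "param_ideal m I d a = (+>\<^bsub>xring m\<^esub>) I ` fibre a"
  by (simp add: param_ideal_def)

lemma reduction_param_ideal_iff:
  "reduction (quot_alg m I) (quot_comp m I) (param_ideal m I d a) \<longleftrightarrow>
    (\<exists>n0. \<forall>n\<ge>n0. {p. form {1..m} n p} \<subseteq> fibre a)"
proof -
  have "param_ideal m I d a = Idl\<^bsub>quot_alg m I\<^esub> ((+>\<^bsub>xring m\<^esub>) I ` (lin_form m a ` {1..d}))"
    unfolding param_ideal_eq by (rule R.Idl_quot[OF ideal_I lin_forms_carrier, symmetric])
  moreover have "(+>\<^bsub>xring m\<^esub>) I ` (lin_form m a ` {1..d}) \<subseteq> quot_comp m I 1"
    unfolding quot_comp_def using form_lin_form by blast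
  ultimately show ?thesis
    unfolding reduction_def param_ideal_eq quot_comp_Int_iff[OF ideal_fibre I_fibre] by blast
qed

lemma reduction_number_param_ideal:
  "reduction_number (quot_comp m I) (param_ideal m I d a)
    = (LEAST n. {p. form {1..m} (n + 1) p} \<subseteq> fibre a)"
  unfolding reduction_number_def param_ideal_eq quot_comp_Int_iff[OF ideal_fibre I_fibre] ..

text \<open>Let \<open>B\<close> be a basis of those combinations of the \<open>y_i\<close> that lie
  in the preimage \<open>K'\<close> of a smaller reduction \<open>Q'\<close>. If \<open>B\<close>
  has \<open>d\<close> elements, it spans all \<open>y_i\<close> and \<open>Q'\<close> is
  everything. Otherwise \<open>(B, I)\<close> contains the generators of \<open>Q'\<close>, hence
  all forms of large degree, which \<open>no_prime_chain\<close> forbids.\<close>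

lemma minimal_reduction_param_ideal:
  assumes dim: "krull_dim (quot_alg m I) = enat d" "d \<noteq> 0"
    and red: "reduction (quot_alg m I) (quot_comp m I) (param_ideal m I d a)"
  shows "minimal_reduction (quot_alg m I) (quot_comp m I) (param_ideal m I d a)"
  unfolding minimal_reduction_def
proof (intro conjI allI impI red)
  let ?A = "quot_alg m I" and ?G = "quot_comp m I" and ?Q = "param_ideal m I d a"
  let ?\<pi> = "(+>\<^bsub>xring m\<^esub>) I"
  interpret A: ring ?A by (rule ideal.quotient_is_ring[OF ideal_I])
  fix Q' assume Q': "reduction ?A ?G Q' \<and> Q' \<subseteq> ?Q"
  then obtain S n0 where S: "S \<subseteq> ?G 1" "Q' = Idl\<^bsub>?A\<^esub> S" and n0: "\<And>n. n \<ge> n0 \<Longrightarrow> Q' \<inter> ?G n = ?G n"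
    unfolding reduction_def by blast
  have Gc: "?G n \<subseteq> carrier ?A" for n
    unfolding quot_comp_def using R.coset_carrier carrier_form by blast
  have Sc: "S \<subseteq> carrier ?A" using S(1) Gc by blast
  obtain K' where K': "ideal K' (xring m)" "I \<subseteq> K'" "Q' = ?\<pi> ` K'"
    using R.quot_ideal_obtain[OF ideal_I A.genideal_ideal[OF Sc]] unfolding S(2) by blast
  \<comment> \<open>The generating set \<open>S\<close> of \<open>Q'\<close> may be infinite;
    working inside the span of the \<open>y_i\<close> bounds the number of forms by
    \<open>d\<close>.\<close>
  define U where "U = {p \<in> mp.span (lin_form m a ` {1..d}). p \<in> K'}"
  obtain B where B: "B \<subseteq> U" "mp.independent B" "U \<subseteq> mp.span B"
    by (rule mp.maximal_independent_subset)
  have Bspan: "B \<subseteq> mp.span (lin_form m a ` {1..d})" using B(1) by (auto simp: U_def)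
  have fin: "finite (lin_form m a ` {1..d})" by simp
  have cardY: "card (lin_form m a ` {1..d}) \<le> d" using card_image_le[of "{1..d}" "lin_form m a"] by simp
  have finB: "finite B" and cardB: "card B \<le> d"
    using mp.independent_span_bound[OF fin B(2) Bspan] cardY by auto
  have "mp.span (lin_form m a ` {1..d}) \<subseteq> {p. form {1..m} 1 p}"
    by (rule mp.span_minimal[OF image_subsetI subspace_form]) (simp add: form_lin_form)
  then have formB: "form {1..m} 1 b" if "b \<in> B" for b using Bspan that by blast
  have BK': "B \<subseteq> K'" using B(1) by (auto simp: U_def)
  show "Q' = ?Q"
  proof (cases "card B < d")
    case False
    then have "lin_form m a ` {1..d} \<subseteq> mp.span B"
      using cardY by (intro mp.independent_card_spans[OF fin B(2) Bspan]) simp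
    also have "\<dots> \<subseteq> K'" by (rule mp.span_minimal[OF BK' ideal_subspace[OF K'(1)]])
    finally have "fibre a \<subseteq> K'" using K'(2) by (intro Idl_least[OF K'(1)]) simp
    then have "?Q \<subseteq> Q'" unfolding param_ideal_eq K'(3) by blast
    with Q' show ?thesis by blast
  next
    case True
    have Bc: "B \<subseteq> carrier (xring m)" using formB carrier_form by blast
    define L where "L = Idl\<^bsub>xring m\<^esub> (B \<union> I)"
    have L: "ideal L (xring m)" "B \<union> I \<subseteq> L"
      unfolding L_def using Idl_ideal[OF Un_I_carrier[OF Bc]] Idl_incl[OF Un_I_carrier[OF Bc]] by auto
    have IL: "I \<subseteq> L" using L(2) by simp
    \<comment> \<open>A generator lifts to \<open>q + i\<close> with \<open>q\<close> in the span of
      the \<open>y_i\<close> and \<open>i\<close> in \<open>I\<close>; since \<open>I\<close> lies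
      in \<open>K'\<close>, so does \<open>q\<close>, and thus \<open>q\<close> is in the span of
      \<open>B\<close>.\<close>
    have "S \<subseteq> ?\<pi> ` L"
    proof
      fix s assume s: "s \<in> S"
      then obtain p where p: "form {1..m} 1 p" "s = I +>\<^bsub>xring m\<^esub> p"
        using S(1) unfolding quot_comp_def by blast
      have sQ': "s \<in> Q'" using A.genideal_self[OF Sc] s S(2) by blast
      then have pK': "p \<in> K'"
        using R.coset_in_image_iff[OF ideal_I K'(1,2) carrier_form[OF p(1)]] p(2) K'(3) by simp
      have "s \<in> ?\<pi> ` fibre a" using sQ' Q' unfolding param_ideal_eq by blast
      then have "p \<in> fibre a"
        using R.coset_in_image_iff[OF ideal_I ideal_fibre I_fibre carrier_form[OF p(1)]] p(2) by simp
      then obtain q i where qi: "q \<in> mp.span (lin_form m a ` {1..d})" "i \<in> I" "p = q + i"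
        by (rule linear_in_fibre[OF p(1)])
      have "p - i \<in> K'" using qi(2) K'(2) pK' by (intro ideal_diff[OF K'(1)]) auto
      then have "q \<in> U" using qi by (simp add: U_def)
      moreover have "mp.span B \<subseteq> L" using L(2) by (intro mp.span_minimal ideal_subspace[OF L(1)]) simp
      ultimately have "q \<in> L" using B(3) by blast
      then have "p \<in> L" unfolding qi(3) using qi(2) IL by (intro ideal_add[OF L(1)]) auto
      then show "s \<in> ?\<pi> ` L" unfolding p(2) by (rule imageI)
    qed
    then have "Q' \<subseteq> ?\<pi> ` L"
      unfolding S(2) by (intro A.genideal_minimal R.ring_ideal_imp_quot_ideal[OF ideal_I L(1)])
    then have n0L: "{p. form {1..m} n p} \<subseteq> L" if "n \<ge> n0" for n
      using n0[OF that] quot_comp_subset_iff[OF L(1) IL, of n] by blast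
    define Y where "Y = (\<lambda>j. (dg j, f j)) ` {1..v}"
    have sY: "snd ` Y = f ` {1..v}" by (simp add: Y_def image_image)
    have formY: "form {1..m} \<delta> x" if "(\<delta>, x) \<in> Y" for \<delta> x
      using that f by (auto simp: Y_def)
    have LY: "L = Idl\<^bsub>xring m\<^esub> (B \<union> snd ` Y)"
      unfolding L_def I sY by (rule Idl_Un_Idl[OF Bc f_carrier])
    obtain P t where P: "prime_chain {1..m} P d t" "I \<subseteq> P 0"
      by (rule prime_chain_of_krull_dim[OF ideal_I dim])
    have False
    proof (rule no_prime_chain[OF finB formB True formY _ P(1)])
      show "Idl\<^bsub>xring m\<^esub> (snd ` Y) \<subseteq> P 0" using P(2) by (simp add: sY I)
      show "{p. form {1..m} n p} \<subseteq> Idl\<^bsub>xring m\<^esub> (B \<union> snd ` Y)" if "n0 \<le> n" for n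
        using n0L[OF that] unfolding LY .
    qed assumption+
    then show ?thesis ..
  qed
qed

lemma forms_in_fibre_mono:
  assumes "{p. form {1..m} n p} \<subseteq> fibre a" "n \<le> k"
  shows "{p. form {1..m} k p} \<subseteq> fibre a"
  using assms(2,1) by (induction k rule: dec_induct) (auto intro: forms_subset_Suc[OF ideal_fibre, THEN subsetD])

text \<open>Containment of all forms persists in higher degrees, so a failure in degree
  \<open>n\<close> followed by success in degree \<open>n + 1\<close> locates the reduction number
  and also makes the ideal a reduction.\<close>

lemma minimal_reduction_iff:
  assumes dim: "krull_dim (quot_alg m I) = enat d" "d \<noteq> 0" and ne: "I \<noteq> carrier (xring m)"
  shows "minimal_reduction (quot_alg m I) (quot_comp m I) (param_ideal m I d a) \<and>
      reduction_number (quot_comp m I) (param_ideal m I d a) = n \<longleftrightarrow>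
    \<not> {p. form {1..m} n p} \<subseteq> fibre a \<and> {p. form {1..m} (n + 1) p} \<subseteq> fibre a" (is "?L \<longleftrightarrow> ?R")
proof
  assume L: ?L
  then obtain n0 where n0: "\<And>n. n \<ge> n0 \<Longrightarrow> {p. form {1..m} n p} \<subseteq> fibre a"
    unfolding minimal_reduction_def reduction_param_ideal_iff by blast
  have n: "(LEAST n. {p. form {1..m} (n + 1) p} \<subseteq> fibre a) = n"
    using L by (simp add: reduction_number_param_ideal)
  have "{p. form {1..m} (n0 + 1) p} \<subseteq> fibre a" by (rule n0) simp
  from LeastI[of "\<lambda>n. {p. form {1..m} (n + 1) p} \<subseteq> fibre a", OF this]
  have "{p. form {1..m} (n + 1) p} \<subseteq> fibre a" unfolding n .
  \<comment> \<open>The least value only tests degrees from 1 on; in degree 0 the properness of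
    \<open>I\<close> decides.\<close>
  moreover have "\<not> {p. form {1..m} n p} \<subseteq> fibre a"
  proof (cases n)
    case 0
    then show ?thesis using forms_0_not_in_fibre[OF ne] by simp
  next
    case (Suc k)
    then have "k < (LEAST n. {p. form {1..m} (n + 1) p} \<subseteq> fibre a)" unfolding n by simp
    then have "\<not> {p. form {1..m} (k + 1) p} \<subseteq> fibre a" by (rule not_less_Least)
    then show ?thesis unfolding Suc Suc_eq_plus1 .
  qed
  ultimately show ?R by blast
next
  assume R: ?R
  then have "reduction (quot_alg m I) (quot_comp m I) (param_ideal m I d a)"
    unfolding reduction_param_ideal_iff
    by (intro exI[of _ "n + 1"] allI impI) (rule forms_in_fibre_mono[OF conjunct2])
  moreover have "(LEAST n. {p. form {1..m} (n + 1) p} \<subseteq> fibre a) = n"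
  proof (rule Least_equality)
    fix k assume k: "{p. form {1..m} (k + 1) p} \<subseteq> fibre a"
    show "n \<le> k"
    proof (rule ccontr)
      assume "\<not> n \<le> k"
      then have "{p. form {1..m} n p} \<subseteq> fibre a" by (intro forms_in_fibre_mono[OF k]) simp
      with R show False by blast
    qed
  qed (use R in blast)
  ultimately show ?L
    using minimal_reduction_param_ideal[OF dim] by (simp add: reduction_number_param_ideal)
qed

lemma Vvar_antimono: "Vvar m d v f dg (n + 1) \<subseteq> Vvar m d v f dg n"
proof
  fix x assume x: "x \<in> Vvar m d v f dg (n + 1)"
  then obtain \<alpha> where \<alpha>: "\<alpha> \<in> hom_coords (uvars d m)" "x = proj_point \<alpha>"
    unfolding Vvar_def proj_zeros_def proj_space_def by blast
  show "x \<in> Vvar m d v f dg n"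
    using x forms_in_fibre_mono[of n \<alpha> "n + 1"]
    unfolding \<alpha>(2) proj_point_in_Vvar_iff[OF f I \<alpha>(1)] by auto
qed

end

theorem theorem2p1:
  fixes m d v n :: nat
    and I :: "(nat, 'k::field) mpol set"
    and f :: "nat \<Rightarrow> (nat, 'k) mpol"
    and dg :: "nat \<Rightarrow> nat"
  assumes "infinite (UNIV :: 'k set)"
    and "homogeneous_ideal {1..m} I"
    and "I \<noteq> carrier (xring m)"
    and "\<forall>j\<in>{1..v}. form {1..m} (dg j) (f j)"
    and "I = Idl\<^bsub>xring m\<^esub> (f ` {1..v})"
    and "krull_dim (quot_alg m I) = enat d"
  shows "Vvar m d v f dg n \<supseteq> Vvar m d v f dg (n + 1) \<and>
    (\<forall>\<alpha> \<in> hom_coords (uvars d m). \<forall>Q. Q = param_ideal m I d \<alpha> \<longrightarrow>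
       (minimal_reduction (quot_alg m I) (quot_comp m I) Q \<and> reduction_number (quot_comp m I) Q = n
        \<longleftrightarrow> proj_point \<alpha> \<in> Vvar m d v f dg n - Vvar m d v f dg (n + 1)))"
proof (intro conjI ballI allI impI)
  show "Vvar m d v f dg (n + 1) \<subseteq> Vvar m d v f dg n"
    by (rule Vvar_antimono[OF assms(4,5)])
next
  fix \<alpha> Q assume \<alpha>: "\<alpha> \<in> hom_coords (uvars d m)" and Q: "Q = param_ideal m I d \<alpha>"
  \<comment> \<open>For \<open>d = 0\<close> there are no coordinates and hence no points, so the
    case where a Krull dimension of 0 might come from an empty supremum does not arise.\<close>
  have d: "d \<noteq> 0" using \<alpha> by (auto simp: hom_coords_def uvars_def)
  show "minimal_reduction (quot_alg m I) (quot_comp m I) Q \<and> reduction_number (quot_comp m I) Q = n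
      \<longleftrightarrow> proj_point \<alpha> \<in> Vvar m d v f dg n - Vvar m d v f dg (n + 1)"
    unfolding Q Diff_iff proj_point_in_Vvar_iff[OF assms(4,5) \<alpha>]
      minimal_reduction_iff[OF assms(4,5,6) d assms(3)] not_not ..
qed

end
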